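(* Let $X$ be a Banach space and let $\{T_\eta\}_{\eta\in[0,1]}\subset C(X)$ be a collectively asymptotically compact and continuous family at $\eta=0$. Assume that: (a) $T_\eta$ has a global attractor $\mathcal A_\eta$ for each $\eta\in[0,1]$ and $\bigcup_{\eta\in[0,1]}\mathcal A_\eta$ is precompact in $X$; (b) there is a neighborhood $U$ of $\bigcup_{\eta\in[0,1]}\mathcal A_\eta$ such that $|\!|\!|T_\eta-T_0|\!|\!|_U\to0$ as $\eta\to0^+$; (c) there exists $p\in\mathbb N$ such that $T_\eta$ has a family of isolated invariants $\mathfrak E_\eta=\{x^\ast_{1,\eta},\ldots,x^\ast_{p,\eta}\}$ for each $\eta\in[0,1]$, consisting only of equilibria; (d) all points in $\mathfrak E_0$ are $\mathfrak L$-hyperbolic; (e) $T_0$ is dynamically gradient with respect to $\mathfrak E_0$. Then there exists $\eta_1>0$ such that $T_\eta$ is dynamically gradient with respect to $\mathfrak E_\eta$ and $$\mathcal A_\eta=\bigcup_{i=1}^pW^{\rm u}(x^\ast_{i,\eta}),\quad\text{for each }\eta\in[0,\eta_1],$$ where $W^{\rm u}(x^\ast_{i,\eta})$ is the set of $x\in X$ for which there exists a global solution $\xi$ of $T_\eta$ such that $\xi(0)=x$ and $\|\xi(m)-x^\ast_{i,\eta}\|\to0$ as $m\to-\infty$.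
   Context: $C(X)$ is the set of continuous maps $X\to X$; an equilibrium point of $T$ is $x$ with $T(x)=x$; a global solution of $T$ is $\xi\colon\mathbb Z\to X$ with $T(\xi(m))=\xi(m+1)$ for all $m$. A map is bi-Lipschitz if it is invertible and it and its inverse are Lipschitz. For a map $T$ on $U\subset X$: $|\!|\!|T|\!|\!|_U=\max\{\sup_{x\in U}\|T(x)\|,\ \sup_{x\neq y\in U}\frac{\|T(x)-T(y)\|}{\|x-y\|}\}$. A global attractor of $T$ is a compact set $\mathcal A$ with $T(\mathcal A)=\mathcal A$ and $\sup_{x\in B}d(T^nx,\mathcal A)\to0$ as $n\to\infty$ for every bounded $B\subset X$. The family $\{T_\eta\}$ is continuous at $\eta=0$ if $\max_{1\leqslant n\leqslant M}\sup_{x\in K}\|T_\eta^n(x)-T_0^n(x)\|\to0$ as $\eta\to0^+$ for every compact $K\subset X$ and $M\in\mathbb N$. It is collectively asymptotically compact if, whenever $\eta_k\to0^+$, $n_k\to\infty$, $\{x_k\}$ is bounded and $\{T^{n_k}_{\eta_k}(x_k)\}$ is bounded, then $\{T^{n_k}_{\eta_k}(x_k)\}$ has a convergent subsequence. Let $\mathcal A$ be the global attractor of $T$ and $\mathcal O_r(\Xi)=\{x:d(x,\Xi)<r\}$. A set $\Xi\subset\mathcal A$ is an isolated invariant for $T$ if $T(\Xi)=\Xi$ and, for some $r>0$, every $B\subset\mathcal O_r(\Xi)$ with $T(B)=B$ satisfies $B\subset\Xi$. A family $\{\Xi_1,\ldots,\Xi_p\}$ of isolated invariants is disjoint if $\mathcal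 O_{r_0}(\Xi_i)\cap\mathcal O_{r_0}(\Xi_j)=\varnothing$ for $i\neq j$ and some $r_0>0$; families of isolated invariants are understood to be disjoint families, and a point $x$ is identified with $\{x\}$. A heteroclinic structure in $\{\Xi_1,\ldots,\Xi_p\}$ is a subset $\{\Xi_{k_1},\ldots,\Xi_{k_\ell}\}$ together with bounded global solutions $\xi_1,\ldots,\xi_\ell$ of $T$, none of them entirely contained in a single $\Xi_j$, such that $d(\xi_i(m),\Xi_{k_i})\to0$ as $m\to-\infty$ and $d(\xi_i(m),\Xi_{k_{i+1}})\to0$ as $m\to\infty$, with $\Xi_{k_{\ell+1}}:=\Xi_{k_1}$. $T$ is dynamically gradient with respect to $\{\Xi_1,\ldots,\Xi_p\}$ if (DG1) for each bounded global solution $\xi$ there are $i,j$ with $d(\xi(m),\Xi_i)\to0$ as $m\to-\infty$ and $d(\xi(m),\Xi_j)\to0$ as $m\to\infty$; (DG2) there are no heteroclinic structures in the family. Weakly hyperbolic points. Let $L$ be a bounded linear operator on $X$ with $\sigma(L)\cap\{|\lambda|=1\}=\varnothing$. Put $\pi_s=\frac1{2\pi i}\int_{|\lambda|=1}(\lambda-L)^{-1}d\lambda$, $\pi_u=I-\pi_s$, $X_j=\pi_jX$, $L_j=L|_{X_j}$ ($j=u,s$). One has $0<b<1<a$ with $\sigma(L_s)\subset\{|\lambda|<b\}$, $\sigma(L_u)\subset\{|\lambda|>a\}$, and $X$ is equipped with an equivalent norm satisfying $\|L_s\|\leqslant b$, $\|L_u^{-1}\|\leqslant a^{-1}$, $\|x_u+x_s\|=\max\{\|x_u\|,\|x_s\|\}$.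 An equilibrium point $x^\ast$ of $T$ is weakly hyperbolic if $S(x)=T(x+x^\ast)-x^\ast$ has a decomposition $S=L+N$ with: (i) $L,a,b$ and the norm as just described; (ii) there are a neighborhood $U_0$ of $0$ and $\gamma={\rm Lip}(N)>0$ with $b+2\gamma<1<a-2\gamma$ and $\|N(x)-N(y)\|\leqslant\gamma\|x-y\|$ on $U_0$; (iii) $0<\gamma\|(I-L)^{-1}\|\leqslant1$. Local manifolds. For a weakly hyperbolic point $x^\ast$ of $T$, $W^{\rm s}_{loc}(x^\ast)$ and $W^{\rm u}_{loc}(x^\ast)$ denote the local stable and unstable manifolds: for suitable $\epsilon_0>0$ and neighborhoods $O'$ of $x^\ast$ and $V_u,V_s$ of $0$ in $X_u,X_s$, they are graphs of Lipschitz maps over $x^\ast+V_s$ and $x^\ast+V_u$ respectively, and $W^{\rm s}_{loc}(x^\ast)=\{x\in O': T^nx\in O'\ \forall n\geqslant0,\ \|T^nx-x^\ast\|=o((1-\epsilon_0)^n)\}$, $W^{\rm u}_{loc}(x^\ast)=\{x\in O':\exists\{x_j\}_{j\leqslant0}\subset O',\ x_0=x,\ x_{j+1}=T(x_j),\ \sup_{j\leqslant0}(1+\epsilon_0)^{-j}\|x_j-x^\ast\|<\infty\}$. $\mathfrak L$-hyperbolic points. A weakly hyperbolic point $x^\ast$ of $T$, with decomposition $S=L+N$, is $\mathfrak L$-hyperbolic if ${\rm Lip}(N)<\gamma_1$, where $\gamma_1=\gamma_1(L)>0$ is a constant (whose existence the paper proves) with the following property: if $R\in C(X)$ has $0$ as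 a weakly hyperbolic point with decomposition $R=L+N$ and ${\rm Lip}(N)<\gamma_1$, then there are neighborhoods $O,V_u,V_s$ of $0$ in $X,X_u,X_s$ and a bi-Lipschitz map $g\colon X\to X$ with $g(0)=0$ such that $0$ is a weakly hyperbolic point of $R_1=g^{-1}\circ R\circ g$ with decomposition $R_1=L+N_1$, and the local manifolds of $0$ for $R_1$ satisfy $W^{\rm u,1}_{loc}(0)\cap O=V_u$, $W^{\rm s,1}_{loc}(0)\cap O=V_s$; in particular $\pi_uN_1(x_s)=0=\pi_sN_1(x_u)$ for $x_u\in V_u$, $x_s\in V_s$. *)

theory Defs
  imports "HOL-Analysis.Analysis" "HOL-Library.Landau_Symbols"
begin

definition equilibrium :: "('a \<Rightarrow> 'a) \<Rightarrow> 'a \<Rightarrow> bool" where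
  "equilibrium T x \<longleftrightarrow> T x = x"

definition global_solution :: "('a \<Rightarrow> 'a) \<Rightarrow> (int \<Rightarrow> 'a) \<Rightarrow> bool" where
  "global_solution T \<xi> \<longleftrightarrow> (\<forall>m. T (\<xi> m) = \<xi> (m + 1))"

text \<open>
  \<open>infdist x {}\<close> is \<open>0\<close> in the library, whereas the distance to the empty set is understood
  to be infinite here.  For this reason attractors and isolated invariants are required to be
  nonempty.  \<open>uniform_limit\<close> expresses that the supremum over \<open>B\<close> of the distances tends to 0.
\<close>

definition global_attractor :: "('a::metric_space \<Rightarrow> 'a) \<Rightarrow> 'a set \<Rightarrow> bool" where
  "global_attractor T A \<longleftrightarrow>
     A \<noteq> {} \<and> compact A \<and> T ` A = A \<and>
     (\<forall>B. bounded B \<longrightarrow>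
        uniform_limit B (\<lambda>n x. infdist ((T ^^ n) x) A) (\<lambda>x. 0) sequentially)"

definition nbhd_radius :: "real \<Rightarrow> 'a::metric_space set \<Rightarrow> 'a set" where
  "nbhd_radius r \<Xi> = {x. infdist x \<Xi> < r}"

definition isolated_invariant ::
  "('a::metric_space \<Rightarrow> 'a) \<Rightarrow> 'a set \<Rightarrow> 'a set \<Rightarrow> bool" where
  "isolated_invariant T A \<Xi> \<longleftrightarrow>
     \<Xi> \<noteq> {} \<and> \<Xi> \<subseteq> A \<and> T ` \<Xi> = \<Xi> \<and>
     (\<exists>r>0. \<forall>B. B \<subseteq> nbhd_radius r \<Xi> \<and> T ` B = B \<longrightarrow> B \<subseteq> \<Xi>)"

definition isolated_invariant_family ::
  "('a::metric_space \<Rightarrow> 'a) \<Rightarrow> 'a set \<Rightarrow> nat \<Rightarrow> (nat \<Rightarrow> 'a set) \<Rightarrow> bool" where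
  "isolated_invariant_family T A p \<Xi> \<longleftrightarrow>
     (\<forall>i\<in>{1..p}. isolated_invariant T A (\<Xi> i)) \<and>
     (\<exists>r0>0. \<forall>i\<in>{1..p}. \<forall>j\<in>{1..p}. i \<noteq> j \<longrightarrow>
        nbhd_radius r0 (\<Xi> i) \<inter> nbhd_radius r0 (\<Xi> j) = {})"

definition backward_to :: "(int \<Rightarrow> 'a::metric_space) \<Rightarrow> 'a set \<Rightarrow> bool" where
  "backward_to \<xi> \<Xi> \<longleftrightarrow> ((\<lambda>m. infdist (\<xi> m) \<Xi>) \<longlongrightarrow> 0) at_bot"

definition forward_to :: "(int \<Rightarrow> 'a::metric_space) \<Rightarrow> 'a set \<Rightarrow> bool" where
  "forward_to \<xi> \<Xi> \<longleftrightarrow> ((\<lambda>m. infdist (\<xi> m) \<Xi>) \<longlongrightarrow> 0) at_top"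

definition heteroclinic_structure ::
  "('a::metric_space \<Rightarrow> 'a) \<Rightarrow> nat \<Rightarrow> (nat \<Rightarrow> 'a set) \<Rightarrow>
     nat \<Rightarrow> (nat \<Rightarrow> nat) \<Rightarrow> (nat \<Rightarrow> int \<Rightarrow> 'a) \<Rightarrow> bool" where
  "heteroclinic_structure T p \<Xi> l k \<xi> \<longleftrightarrow>
     l \<ge> 1 \<and> (\<forall>i\<in>{1..l}. k i \<in> {1..p}) \<and> inj_on k {1..l} \<and> k (l + 1) = k 1 \<and>
     (\<forall>i\<in>{1..l}.
        global_solution T (\<xi> i) \<and> bounded (range (\<xi> i)) \<and>
        (\<forall>j\<in>{1..p}. \<not> range (\<xi> i) \<subseteq> \<Xi> j) \<and>
        backward_to (\<xi> i) (\<Xi> (k i)) \<and> forward_to (\<xi> i) (\<Xi> (k (i + 1))))"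

definition dynamically_gradient ::
  "('a::metric_space \<Rightarrow> 'a) \<Rightarrow> nat \<Rightarrow> (nat \<Rightarrow> 'a set) \<Rightarrow> bool" where
  "dynamically_gradient T p \<Xi> \<longleftrightarrow>
     (\<forall>\<xi>. global_solution T \<xi> \<and> bounded (range \<xi>) \<longrightarrow>
        (\<exists>i\<in>{1..p}. \<exists>j\<in>{1..p}. backward_to \<xi> (\<Xi> i) \<and> forward_to \<xi> (\<Xi> j))) \<and>
     \<not> (\<exists>l k \<xi>. heteroclinic_structure T p \<Xi> l k \<xi>)"

definition unstable_set :: "('a::real_normed_vector \<Rightarrow> 'a) \<Rightarrow> 'a \<Rightarrow> 'a set" where
  "unstable_set T x0 =
     {x. \<exists>\<xi>. global_solution T \<xi> \<and> \<xi> 0 = x \<and> ((\<lambda>m. norm (\<xi> m - x0)) \<longlongrightarrow> 0) at_bot}"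

definition continuous_family_at_0 :: "(real \<Rightarrow> 'a::real_normed_vector \<Rightarrow> 'a) \<Rightarrow> bool" where
  "continuous_family_at_0 T \<longleftrightarrow>
     (\<forall>K M. compact K \<longrightarrow>
        uniform_limit ({1..M} \<times> K) (\<lambda>\<eta> (n, x). (T \<eta> ^^ n) x) (\<lambda>(n, x). (T 0 ^^ n) x) (at_right 0))"

definition collectively_asymptotically_compact ::
  "(real \<Rightarrow> 'a::metric_space \<Rightarrow> 'a) \<Rightarrow> bool" where
  "collectively_asymptotically_compact T \<longleftrightarrow>
     (\<forall>(\<eta> :: nat \<Rightarrow> real) (n :: nat \<Rightarrow> nat) (x :: nat \<Rightarrow> 'a).
        (\<forall>k. \<eta> k \<in> {0<..1}) \<and> \<eta> \<longlonglongrightarrow> 0 \<and> filterlim n at_top sequentially \<and>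
        bounded (range x) \<and> bounded (range (\<lambda>k. (T (\<eta> k) ^^ n k) (x k))) \<longrightarrow>
        (\<exists>r. strict_mono r \<and> convergent ((\<lambda>k. (T (\<eta> k) ^^ n k) (x k)) \<circ> r)))"

text \<open>\<open>C\<^sup>0\<close>-plus-Lipschitz norm of a map on a set; \<open>\<infinity>\<close> if it is unbounded or not Lipschitz there.\<close>

definition triple_norm_on :: "'a set \<Rightarrow> ('a::real_normed_vector \<Rightarrow> 'a) \<Rightarrow> ennreal" where
  "triple_norm_on U F =
     max (SUP x\<in>U. ennreal (norm (F x)))
         (SUP (x, y)\<in>{(x, y). x \<in> U \<and> y \<in> U \<and> x \<noteq> y}. ennreal (norm (F x - F y) / norm (x - y)))"

text \<open>
  The scalars are real, so the spectrum is that of the complexification: \<open>'a \<times> 'a\<close> with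
  \<open>(x, y)\<close> standing for \<open>x + \<i>y\<close>.  For a complex-linear operator on a complex Banach space (viewed
  as a real one) this spectrum is the union of the complex spectrum and its conjugate, and the
  projections below are the complex spectral projections.
\<close>

definition cscale :: "complex \<Rightarrow> 'a::real_vector \<times> 'a \<Rightarrow> 'a \<times> 'a" where
  "cscale z w = (Re z *\<^sub>R fst w - Im z *\<^sub>R snd w, Im z *\<^sub>R fst w + Re z *\<^sub>R snd w)"

definition char_op :: "('a::real_vector \<Rightarrow> 'a) \<Rightarrow> complex \<Rightarrow> 'a \<times> 'a \<Rightarrow> 'a \<times> 'a" where
  "char_op L z w = cscale z w - (L (fst w), L (snd w))"

text \<open>Spectrum of the restriction of \<open>L\<close> to an invariant subspace \<open>V\<close>: the set of \<open>z\<close> for which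
  \<open>z - L\<close> has no bounded inverse on (the complexification of) \<open>V\<close>.\<close>

definition spectrum_on :: "'a set \<Rightarrow> ('a::real_normed_vector \<Rightarrow> 'a) \<Rightarrow> complex set" where
  "spectrum_on V L =
     {z. \<not> (bij_betw (char_op L z) (V \<times> V) (V \<times> V) \<and>
            (\<exists>C. \<forall>w\<in>V \<times> V. norm (inv_into (V \<times> V) (char_op L z) w) \<le> C * norm w))}"

text \<open>
  \<open>(1 / 2\<pi>\<i>) \<ointegral> (\<lambda> - L)\<^sup>-\<^sup>1 d\<lambda>\<close> over the unit circle, with \<open>\<lambda> = e\<^sup>\<i>\<^sup>t\<close>, \<open>d\<lambda> = \<i> e\<^sup>\<i>\<^sup>t dt\<close>,
  applied to the real vector \<open>x\<close>; the imaginary part vanishes by conjugation symmetry.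
\<close>

definition stable_proj :: "('a::banach \<Rightarrow> 'a) \<Rightarrow> 'a \<Rightarrow> 'a" where
  "stable_proj L x =
     fst ((1 / (2 * pi)) *\<^sub>R
       integral {0..2 * pi} (\<lambda>t. cscale (cis t) (inv (char_op L (cis t)) (x, 0))))"

definition unstable_proj :: "('a::banach \<Rightarrow> 'a) \<Rightarrow> 'a \<Rightarrow> 'a" where
  "unstable_proj L x = x - stable_proj L x"

definition stable_space :: "('a::banach \<Rightarrow> 'a) \<Rightarrow> 'a set" where
  "stable_space L = range (stable_proj L)"

definition unstable_space :: "('a::banach \<Rightarrow> 'a) \<Rightarrow> 'a set" where
  "unstable_space L = range (unstable_proj L)"

definition equivalent_norm :: "('a::real_normed_vector \<Rightarrow> real) \<Rightarrow> bool" where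
  "equivalent_norm nrm \<longleftrightarrow>
     (\<forall>x y. nrm (x + y) \<le> nrm x + nrm y) \<and>
     (\<forall>c x. nrm (c *\<^sub>R x) = \<bar>c\<bar> * nrm x) \<and>
     (\<exists>c>0. \<exists>C>0. \<forall>x. c * norm x \<le> nrm x \<and> nrm x \<le> C * norm x)"

definition op_norm_on :: "('a \<Rightarrow> real) \<Rightarrow> 'a set \<Rightarrow> ('a \<Rightarrow> 'a) \<Rightarrow> ennreal" where
  "op_norm_on nrm V F = (SUP x\<in>V. ennreal (nrm (F x) / nrm x))"

definition hyperbolic_operator ::
  "('a::banach \<Rightarrow> 'a) \<Rightarrow> real \<Rightarrow> real \<Rightarrow> ('a \<Rightarrow> real) \<Rightarrow> bool" where
  "hyperbolic_operator L a b nrm \<longleftrightarrow>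
     bounded_linear L \<and> spectrum_on UNIV L \<inter> {z. cmod z = 1} = {} \<and>
     0 < b \<and> b < 1 \<and> 1 < a \<and>
     spectrum_on (stable_space L) L \<subseteq> {z. cmod z < b} \<and>
     spectrum_on (unstable_space L) L \<subseteq> {z. cmod z > a} \<and>
     equivalent_norm nrm \<and>
     op_norm_on nrm (stable_space L) L \<le> ennreal b \<and>
     op_norm_on nrm (unstable_space L) (inv_into (unstable_space L) L) \<le> ennreal (1 / a) \<and>
     (\<forall>xu\<in>unstable_space L. \<forall>xs\<in>stable_space L. nrm (xu + xs) = max (nrm xu) (nrm xs))"

text \<open>
  The map \<open>x \<mapsto> T (x + x0) - x0\<close> has the decomposition \<open>L + N\<close> with data \<open>a\<close>, \<open>b\<close>, \<open>nrm\<close>.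
  The number \<open>\<gamma>\<close> plays the role of \<open>Lip N\<close>: a positive Lipschitz constant, with respect to
  \<open>nrm\<close>, of \<open>N\<close> near 0 (not necessarily the smallest one, so that \<open>N = 0\<close> is allowed).
\<close>

definition weakly_hyperbolic_decomposition ::
  "('a::banach \<Rightarrow> 'a) \<Rightarrow> 'a \<Rightarrow> ('a \<Rightarrow> 'a) \<Rightarrow> ('a \<Rightarrow> 'a) \<Rightarrow>
     real \<Rightarrow> real \<Rightarrow> ('a \<Rightarrow> real) \<Rightarrow> real \<Rightarrow> bool" where
  "weakly_hyperbolic_decomposition T x0 L N a b nrm \<gamma> \<longleftrightarrow>
     equilibrium T x0 \<and>
     (\<forall>x. T (x + x0) - x0 = L x + N x) \<and>
     hyperbolic_operator L a b nrm \<and>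
     \<gamma> > 0 \<and> b + 2 * \<gamma> < 1 \<and> 1 < a - 2 * \<gamma> \<and>
     (\<exists>U0. 0 \<in> interior U0 \<and> (\<forall>x\<in>U0. \<forall>y\<in>U0. nrm (N x - N y) \<le> \<gamma> * nrm (x - y))) \<and>
     0 < ennreal \<gamma> * op_norm_on nrm UNIV (inv (\<lambda>x. x - L x)) \<and>
     ennreal \<gamma> * op_norm_on nrm UNIV (inv (\<lambda>x. x - L x)) \<le> 1"

definition nbhd_0_in :: "'a::real_normed_vector set \<Rightarrow> 'a set \<Rightarrow> bool" where
  "nbhd_0_in S V \<longleftrightarrow> V \<subseteq> S \<and> 0 \<in> top_of_set S interior_of V"

definition lipschitz_graph_over ::
  "'a::real_normed_vector \<Rightarrow> 'a set \<Rightarrow> 'a set \<Rightarrow> 'a set \<Rightarrow> bool" where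
  "lipschitz_graph_over x0 V Y W \<longleftrightarrow>
     (\<exists>h C. C-lipschitz_on V h \<and> h ` V \<subseteq> Y \<and> W = (\<lambda>v. x0 + v + h v) ` V)"

definition local_stable_set ::
  "('a::real_normed_vector \<Rightarrow> 'a) \<Rightarrow> 'a \<Rightarrow> real \<Rightarrow> 'a set \<Rightarrow> 'a set" where
  "local_stable_set T x0 \<epsilon> O' =
     {x\<in>O'. (\<forall>n. (T ^^ n) x \<in> O') \<and> (\<lambda>n. norm ((T ^^ n) x - x0)) \<in> o(\<lambda>n. (1 - \<epsilon>) ^ n)}"

definition local_unstable_set ::
  "('a::real_normed_vector \<Rightarrow> 'a) \<Rightarrow> 'a \<Rightarrow> real \<Rightarrow> 'a set \<Rightarrow> 'a set" where
  "local_unstable_set T x0 \<epsilon> O' =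
     {x\<in>O'. \<exists>y :: int \<Rightarrow> 'a. (\<forall>j\<le>0. y j \<in> O') \<and> y 0 = x \<and> (\<forall>j<0. y (j + 1) = T (y j)) \<and>
        bdd_above ((\<lambda>j. (1 + \<epsilon>) powi (- j) * norm (y j - x0)) ` {..0})}"

text \<open>\<open>Ws\<close> and \<open>Wu\<close> are local stable and unstable manifolds of \<open>x0\<close>, for some admissible choice of
  the rate \<open>\<epsilon>\<close> and of the neighbourhoods.\<close>

definition local_manifolds ::
  "('a::banach \<Rightarrow> 'a) \<Rightarrow> 'a \<Rightarrow> ('a \<Rightarrow> 'a) \<Rightarrow> 'a set \<Rightarrow> 'a set \<Rightarrow> bool" where
  "local_manifolds T x0 L Ws Wu \<longleftrightarrow>
     (\<exists>\<epsilon> O' Vs Vu. 0 < \<epsilon> \<and> \<epsilon> < 1 \<and> x0 \<in> interior O' \<and>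
        nbhd_0_in (stable_space L) Vs \<and> nbhd_0_in (unstable_space L) Vu \<and>
        Ws = local_stable_set T x0 \<epsilon> O' \<and> Wu = local_unstable_set T x0 \<epsilon> O' \<and>
        lipschitz_graph_over x0 Vs (unstable_space L) Ws \<and>
        lipschitz_graph_over x0 Vu (stable_space L) Wu)"

definition bi_lipschitz :: "('a::metric_space \<Rightarrow> 'a) \<Rightarrow> bool" where
  "bi_lipschitz g \<longleftrightarrow>
     bij g \<and> (\<exists>C. C-lipschitz_on UNIV g) \<and> (\<exists>C. C-lipschitz_on UNIV (inv g))"

text \<open>The defining property of the constant \<open>\<gamma>1\<close>: below it, the local manifolds can be
  straightened by a bi-Lipschitz change of variables.\<close>

definition straightening_constant ::
  "('a::banach \<Rightarrow> 'a) \<Rightarrow> real \<Rightarrow> real \<Rightarrow> ('a \<Rightarrow> real) \<Rightarrow> real \<Rightarrow> bool" where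
  "straightening_constant L a b nrm \<gamma>1 \<longleftrightarrow>
     \<gamma>1 > 0 \<and>
     (\<forall>R N \<gamma>. continuous_on UNIV R \<and>
        weakly_hyperbolic_decomposition R 0 L N a b nrm \<gamma> \<and> \<gamma> < \<gamma>1 \<longrightarrow>
        (\<exists>G Vu Vs g N1 \<gamma>' Ws Wu.
           0 \<in> interior G \<and>
           nbhd_0_in (unstable_space L) Vu \<and> nbhd_0_in (stable_space L) Vs \<and>
           bi_lipschitz g \<and> g 0 = 0 \<and>
           weakly_hyperbolic_decomposition (inv g \<circ> R \<circ> g) 0 L N1 a b nrm \<gamma>' \<and>
           local_manifolds (inv g \<circ> R \<circ> g) 0 L Ws Wu \<and>
           Wu \<inter> G = Vu \<and> Ws \<inter> G = Vs \<and>
           (\<forall>xs\<in>Vs. unstable_proj L (N1 xs) = 0) \<and>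
           (\<forall>xu\<in>Vu. stable_proj L (N1 xu) = 0)))"

definition L_hyperbolic :: "('a::banach \<Rightarrow> 'a) \<Rightarrow> 'a \<Rightarrow> bool" where
  "L_hyperbolic T x0 \<longleftrightarrow>
     (\<exists>L N a b nrm \<gamma> \<gamma>1. weakly_hyperbolic_decomposition T x0 L N a b nrm \<gamma> \<and>
        straightening_constant L a b nrm \<gamma>1 \<and> \<gamma> < \<gamma>1)"

end

theory Submission
  imports Defs
begin

text \<open>
  The theorem combines a local fact, which hyperbolicity gives uniformly in \<open>\<eta>\<close>, with a global
  compactness argument, which excludes long-range changes of the dynamics.

  Locally, let \<open>S\<close> be \<open>T 0\<close> plus a perturbation with a small Lipschitz constant, near a weakly
  hyperbolic equilibrium. The difference of two orbits of \<open>S\<close> either lies in the unstable cone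
  \<open>\<bar>d\<^sub>s\<bar> \<le> \<bar>d\<^sub>u\<bar>\<close>, stays there and grows geometrically, or lies in the stable cone, where its
  stable part shrinks geometrically. Two orbits that stay in a fixed ball for all positive times never
  have their difference inside the unstable cone, so they are forward asymptotic; in the same way
  orbits that stay in the ball for all negative times are backward asymptotic, and a ball contains at
  most one full orbit
  (\<open>weakly_hyperbolic_imp_synchronizing\<close>). The gap conditions \<open>b + 2\<gamma> < 1 < a - 2\<gamma>\<close> leave
  room for the perturbation, so one ball around each equilibrium of \<open>T 0\<close> serves all small \<open>\<eta>\<close>.

  Globally, a bounded solution of \<open>T \<eta>\<close> lies in the attractor \<open>A \<eta>\<close>, hence in one fixed compact
  set \<open>K\<close>, and is there a \<open>\<delta>\<close>-pseudo-orbit of \<open>T 0\<close>, with \<open>\<delta> \<rightarrow> 0\<close> as \<open>\<eta> \<rightarrow> 0\<close>.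
  Pointwise limits of \<open>\<delta>\<close>-pseudo-orbits with \<open>\<delta> \<rightarrow> 0\<close> are solutions of \<open>T 0\<close>. Consider the
  relation "some nonconstant bounded solution of \<open>T 0\<close> goes from \<open>x\<^sub>i\<close> to \<open>x\<^sub>j\<close>" on
  indices. The absence of heteroclinic structures says that it is acyclic, since a shortest cycle visits
  each equilibrium once. For small \<open>\<delta>\<close>, a \<open>\<delta>\<close>-pseudo-orbit that starts near
  \<open>x\<^sub>i\<close>, leaves the ball around it and later comes near \<open>x\<^sub>j\<close> can exist only if this relation leads
  from \<open>i\<close> to \<open>j\<close> in finitely many steps (\<open>excursions_follow_connections\<close>). In particular
  no pseudo-orbit returns near an equilibrium whose ball it has left. As it also cannot avoid the
  equilibria for long (\<open>uniform_hitting_time\<close>), it finally stays in a single ball, in both time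
  directions, where the local fact makes it converge to an equilibrium of \<open>T \<eta>\<close>.
  A heteroclinic structure of \<open>T \<eta>\<close> would give a cycle of the same relation, which is impossible.

  The indices of \<open>xstar\<close> need not match for different \<open>\<eta>\<close>: each \<open>xstar i \<eta>\<close> is merely near some
  \<open>xstar (\<sigma> i) 0\<close>. By the local uniqueness \<open>\<sigma>\<close> is a permutation, and the claim does not depend
  on the numbering. The formula for the attractor is then immediate: points of the attractor lie on
  bounded solutions, and solutions that are bounded in the past lie in the attractor.
\<close>

section \<open>The spectral projections\<close>

lemma linear_cscale: "linear (cscale z)"
  by (rule linearI) (auto simp: cscale_def algebra_simps)

lemma cscale_diff_left: "cscale (z - z') w = cscale z w - cscale z' w"
  by (simp add: cscale_def algebra_simps)

lemma norm_cscale_le: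
  fixes w :: "'a::real_normed_vector \<times> 'a"
  shows "norm (cscale z w) \<le> 4 * cmod z * norm w"
proof -
  have z: "\<bar>Re z\<bar> \<le> cmod z" "\<bar>Im z\<bar> \<le> cmod z"
    by (auto simp: abs_Re_le_cmod abs_Im_le_cmod)
  have w: "norm (fst w) \<le> norm w" "norm (snd w) \<le> norm w"
    by (cases w; simp add: norm_fst_le norm_snd_le)+
  have part: "norm (s *\<^sub>R u) \<le> cmod z * norm w" if "\<bar>s\<bar> \<le> cmod z" "norm u \<le> norm w" for s and u :: 'a
    using that by (simp add: mult_mono)
  have "norm (cscale z w) \<le> norm (fst (cscale z w)) + norm (snd (cscale z w))"
    using norm_Pair_le[of "fst (cscale z w)" "snd (cscale z w)"] by simp
  also have "\<dots> \<le> (norm (Re z *\<^sub>R fst w) + norm (Im z *\<^sub>R snd w))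
      + (norm (Im z *\<^sub>R fst w) + norm (Re z *\<^sub>R snd w))"
    unfolding cscale_def fst_conv snd_conv
    by (intro add_mono norm_triangle_ineq4 norm_triangle_ineq)
  also have "\<dots> \<le> 4 * cmod z * norm w"
    using part[OF z(1) w(1)] part[OF z(2) w(2)] part[OF z(2) w(1)] part[OF z(1) w(2)] by simp
  finally show ?thesis .
qed

lemma linear_char_op:
  assumes "linear L"
  shows "linear (char_op L z)"
  by (rule linearI)
    (auto simp: char_op_def linear_add[OF assms] linear_scale[OF assms] linear_add[OF linear_cscale]
      linear_scale[OF linear_cscale] algebra_simps)

lemma char_op_diff: "char_op L z w - char_op L z' w = cscale (z - z') w"
  by (simp add: char_op_def cscale_diff_left)

lemma char_op_inverse:
  assumes "z \<notin> spectrum_on UNIV L"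
  shows "bij (char_op L z)" "\<exists>C>0. \<forall>w. norm w \<le> C * norm (char_op L z w)"
proof -
  show bij: "bij (char_op L z)"
    using assms by (simp add: spectrum_on_def)
  obtain C where C: "\<And>w. norm (inv (char_op L z) w) \<le> C * norm w"
    using assms by (auto simp: spectrum_on_def)
  have "norm w \<le> (\<bar>C\<bar> + 1) * norm (char_op L z w)" for w
  proof -
    have "norm w \<le> C * norm (char_op L z w)"
      using C[of "char_op L z w"] bij by (simp add: bij_is_inj inv_f_f)
    also have "\<dots> \<le> (\<bar>C\<bar> + 1) * norm (char_op L z w)"
      by (rule mult_right_mono) auto
    finally show ?thesis .
  qed
  then show "\<exists>C>0. \<forall>w. norm w \<le> C * norm (char_op L z w)"
    by (intro exI[of _ "\<bar>C\<bar> + 1"]) auto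
qed

text \<open>
  If \<open>v\<^sub>s\<close> and \<open>v\<^sub>t\<close> are the preimages of \<open>w\<close> at \<open>s\<close> and \<open>t\<close>, the operator at \<open>t\<close> maps \<open>v\<^sub>s - v\<^sub>t\<close> to
  \<open>(cis t - cis s) v\<^sub>s\<close>. The inverse at the single time \<open>t\<close> is bounded, so
  \<open>v\<^sub>s - v\<^sub>t\<close> is controlled by \<open>\<bar>cis t - cis s\<bar> (\<bar>v\<^sub>s - v\<^sub>t\<bar> + \<bar>v\<^sub>t\<bar>)\<close>, whose first part is
  absorbed for \<open>s\<close> near \<open>t\<close>.
\<close>

lemma continuous_on_resolvent_circle:
  fixes L :: "'a::real_normed_vector \<Rightarrow> 'a"
  assumes lin: "linear L" and spec: "spectrum_on UNIV L \<inter> {z. cmod z = 1} = {}"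
  shows "continuous_on UNIV (\<lambda>t. inv (char_op L (cis t)) w)"
proof (rule continuous_at_imp_continuous_on, intro ballI)
  fix t :: real
  have notin: "cis s \<notin> spectrum_on UNIV L" for s
    using spec by auto
  let ?v = "\<lambda>s. inv (char_op L (cis s)) w"
  obtain C where C: "C > 0" "\<And>u. norm u \<le> C * norm (char_op L (cis t) u)"
    using char_op_inverse(2)[OF notin] by blast
  have eq: "char_op L (cis s) (?v s) = w" for s
    using char_op_inverse(1)[OF notin] by (simp add: bij_is_surj surj_f_inv_f)
  define d where "d s = cmod (cis t - cis s)" for s
  have d0: "(d \<longlongrightarrow> 0) (at t)"
  proof -
    have "isCont (\<lambda>s. cmod (cis t - cis s)) t"
      unfolding cis_conv_exp by (intro continuous_intros)
    then show ?thesis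
      by (simp add: isCont_def d_def[abs_def])
  qed
  have bound: "norm (?v s - ?v t) \<le> 8 * C * norm (?v t) * d s" if small: "8 * C * d s \<le> 1" for s
  proof -
    let ?e = "?v s - ?v t"
    have "char_op L (cis t) ?e = char_op L (cis t) (?v s) - w"
      by (simp add: linear_diff[OF linear_char_op[OF lin]] eq)
    also have "\<dots> = cscale (cis t - cis s) (?v s)"
      using char_op_diff[of L "cis t" "?v s" "cis s"] by (simp add: eq)
    finally have "norm ?e \<le> C * norm (cscale (cis t - cis s) (?v s))"
      using C(2)[of ?e] by simp
    also have "\<dots> \<le> C * (4 * d s * norm (?v s))"
      using norm_cscale_le[of "cis t - cis s" "?v s"] C(1) by (simp add: d_def)
    also have "\<dots> \<le> C * (4 * d s * (norm ?e + norm (?v t)))"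
      using C(1) norm_triangle_sub[of "?v s" "?v t"]
      by (intro mult_left_mono) (auto simp: d_def)
    also have "\<dots> = (8 * C * d s) * norm ?e / 2 + 4 * C * norm (?v t) * d s"
      by (simp add: algebra_simps)
    also have "\<dots> \<le> 1 * norm ?e / 2 + 4 * C * norm (?v t) * d s"
      using mult_right_mono[OF small norm_ge_zero[of ?e]] by simp
    finally show ?thesis
      by simp
  qed
  have "((\<lambda>s. 8 * C * d s) \<longlongrightarrow> 0) (at t)"
    using tendsto_mult_left[OF d0, of "8 * C"] by simp
  then have "eventually (\<lambda>s. 8 * C * d s < 1) (at t)"
    by (rule order_tendstoD) simp
  then have "eventually (\<lambda>s. norm (?v s - ?v t) \<le> 8 * C * norm (?v t) * d s) (at t)"
    by (rule eventually_mono) (simp add: bound)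
  moreover have "((\<lambda>s. 8 * C * norm (?v t) * d s) \<longlongrightarrow> 0) (at t)"
    using tendsto_mult_left[OF d0, of "8 * C * norm (?v t)"] by simp
  ultimately have "((\<lambda>s. ?v s - ?v t) \<longlongrightarrow> 0) (at t)"
    by (rule Lim_null_comparison)
  then show "isCont ?v t"
    by (simp add: isCont_def LIM_zero_iff)
qed

text \<open>
  Continuity of the resolvent is needed here because the integral of a function that is not integrable
  is 0, which would spoil additivity.
\<close>

lemma linear_stable_proj:
  fixes L :: "'a::banach \<Rightarrow> 'a"
  assumes lin: "linear L" and spec: "spectrum_on UNIV L \<inter> {z. cmod z = 1} = {}"
  shows "linear (stable_proj L)"
proof -
  let ?R = "\<lambda>t x. cscale (cis t) (inv (char_op L (cis t)) (x, 0))"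
  have bij: "bij (char_op L (cis t))" for t
    using spec by (intro char_op_inverse) auto
  have lin_inv: "linear (inv (char_op L (cis t)))" for t
    by (rule linearI; rule inv_f_eq[OF bij_is_inj[OF bij]])
      (simp_all add: linear_add[OF linear_char_op[OF lin]] linear_scale[OF linear_char_op[OF lin]]
        surj_f_inv_f[OF bij_is_surj[OF bij]])
  have lin_R: "linear (?R t)" for t
  proof (rule linearI)
    fix x y :: 'a and c :: real
    have "(x + y, 0) = (x, 0::'a) + (y, 0)" "(c *\<^sub>R x, 0) = c *\<^sub>R (x, 0::'a)"
      by auto
    then show "?R t (x + y) = ?R t x + ?R t y" "?R t (c *\<^sub>R x) = c *\<^sub>R ?R t x"
      by (simp_all only: linear_add[OF lin_inv] linear_scale[OF lin_inv]
          linear_add[OF linear_cscale] linear_scale[OF linear_cscale])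
  qed
  have "continuous_on UNIV (\<lambda>t. ?R t x)" for x
    unfolding cscale_def using continuous_on_resolvent_circle[OF lin spec, of "(x, 0)"]
    by (intro continuous_intros) (auto intro!: continuous_intros)
  then have int: "(\<lambda>t. ?R t x) integrable_on {0..2 * pi}" for x
    by (intro integrable_continuous_interval) (rule continuous_on_subset, auto)
  show ?thesis
    by (rule linearI)
      (simp_all add: stable_proj_def linear_add[OF lin_R] linear_scale[OF lin_R] integral_add int
        scaleR_add_right)
qed

text \<open>
  The spectrum on \<open>V\<close> excludes \<open>1\<close> only if \<open>1 - L\<close> maps \<open>V\<close> onto itself, so the spectral
  inclusions already contain the invariance of the two subspaces.
\<close>

lemma invariant_of_one_notin_spectrum_on:
  assumes sub: "subspace V" and "1 \<notin> spectrum_on V L" and "x \<in> V"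
  shows "L x \<in> V"
proof -
  have "char_op L 1 (x, 0) \<in> V \<times> V"
    by (rule bij_betw_apply[of _ "V \<times> V"])
      (use assms subspace_0[OF sub] in \<open>auto simp: spectrum_on_def\<close>)
  then have "x - L x \<in> V"
    by (simp add: char_op_def cscale_def)
  from subspace_diff[OF sub \<open>x \<in> V\<close> this] show ?thesis
    by simp
qed

lemma inj_on_of_zero_notin_spectrum_on:
  assumes sub: "subspace V" and "0 \<notin> spectrum_on V L"
  shows "inj_on L V"
proof (rule inj_onI)
  fix x y assume "x \<in> V" "y \<in> V" "L x = L y"
  then have "char_op L 0 (x, 0) = char_op L 0 (y, 0)"
    by (simp add: char_op_def cscale_def)
  moreover have "inj_on (char_op L 0) (V \<times> V)"
    using assms by (auto simp: spectrum_on_def bij_betw_def)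
  ultimately show "x = y"
    using \<open>x \<in> V\<close> \<open>y \<in> V\<close> subspace_0[OF sub] by (auto dest: inj_onD)
qed

text \<open>
  What the cone estimates use of a hyperbolic operator. The projections commute with \<open>L\<close> because
  \<open>L\<close> preserves both subspaces and these meet only in 0: a vector \<open>e\<close> with \<open>e\<close> unstable
  and \<open>- e\<close> stable has \<open>max (nrm e) (nrm (- e)) = nrm 0\<close>. The expansion bound is the bound on
  the inverse of \<open>L\<close> on the unstable space, read at \<open>L d\<close>.
\<close>

lemma hyperbolic_operator_splitting:
  fixes L :: "'a::banach \<Rightarrow> 'a"
  assumes "hyperbolic_operator L a b nrm"
  shows "linear (stable_proj L)" "linear (unstable_proj L)"
    "nrm d = max (nrm (unstable_proj L d)) (nrm (stable_proj L d))"
    "unstable_proj L (L d) = L (unstable_proj L d)"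
    "stable_proj L (L d) = L (stable_proj L d)"
    "nrm (L (stable_proj L d)) \<le> b * nrm (stable_proj L d)"
    "a * nrm (unstable_proj L d) \<le> nrm (L (unstable_proj L d))"
proof -
  let ?s = "stable_proj L" and ?u = "unstable_proj L"
  have blin: "bounded_linear L" and spec: "spectrum_on UNIV L \<inter> {z. cmod z = 1} = {}"
    and b: "0 < b" "b < 1" and a: "1 < a"
    and specs: "spectrum_on (stable_space L) L \<subseteq> {z. cmod z < b}"
    and specu: "spectrum_on (unstable_space L) L \<subseteq> {z. cmod z > a}"
    and nrm: "equivalent_norm nrm"
    and ops: "op_norm_on nrm (stable_space L) L \<le> ennreal b"
    and opu: "op_norm_on nrm (unstable_space L) (inv_into (unstable_space L) L) \<le> ennreal (1 / a)"
    and mx: "\<And>xu xs. xu \<in> unstable_space L \<Longrightarrow> xs \<in> stable_space L \<Longrightarrow> nrm (xu + xs) = max (nrm xu) (nrm xs)"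
    using assms unfolding hyperbolic_operator_def by auto
  have lin: "linear L"
    using blin by (rule bounded_linear.linear)
  show lins: "linear ?s"
    using lin spec by (rule linear_stable_proj)
  show linu: "linear ?u"
    unfolding unstable_proj_def[abs_def] by (intro linear_compose_sub lins linear_ident)
  have subs: "subspace (stable_space L)" and subu: "subspace (unstable_space L)"
    unfolding stable_space_def unstable_space_def
    by (auto intro: linear_subspace_image lins linu)
  have mem: "?s d \<in> stable_space L" "?u d \<in> unstable_space L" for d
    by (auto simp: stable_space_def unstable_space_def)
  have sum: "?u d + ?s d = d" for d
    by (simp add: unstable_proj_def)
  show "nrm d = max (nrm (?u d)) (nrm (?s d))" for d
    using mx[OF mem(2) mem(1), of d d] by (simp add: sum)
  obtain c where c: "c > 0" "\<And>x. c * norm x \<le> nrm x"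
    using nrm by (auto simp: equivalent_norm_def)
  have pos: "0 \<le> nrm x" "nrm x \<le> 0 \<longleftrightarrow> x = 0" for x
  proof -
    show "0 \<le> nrm x"
      using c(1) by (intro order_trans[OF _ c(2)]) auto
    have "nrm (0 *\<^sub>R 0) = \<bar>0\<bar> * nrm 0"
      using nrm unfolding equivalent_norm_def by blast
    moreover have "norm x \<le> 0" if "nrm x \<le> 0"
      using c(1) order_trans[OF c(2) that] by (simp add: mult_le_0_iff)
    ultimately show "nrm x \<le> 0 \<longleftrightarrow> x = 0"
      by auto
  qed
  have Ls: "L x \<in> stable_space L" if "x \<in> stable_space L" for x
    using b specs by (intro invariant_of_one_notin_spectrum_on[OF subs _ that]) auto
  have Lu: "L x \<in> unstable_space L" if "x \<in> unstable_space L" for x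
    using a specu by (intro invariant_of_one_notin_spectrum_on[OF subu _ that]) auto
  show "?u (L d) = L (?u d)" "?s (L d) = L (?s d)" for d
  proof -
    let ?e = "?u (L d) - L (?u d)"
    have "L (?u d) + L (?s d) = L d"
      by (simp add: sum flip: linear_add[OF lin])
    then have e: "?e = L (?s d) - ?s (L d)"
      by (simp add: unstable_proj_def algebra_simps)
    have "?e \<in> unstable_space L"
      by (intro subspace_diff subu mem Lu)
    moreover have "- ?e \<in> stable_space L"
      unfolding e by (intro subspace_neg subspace_diff subs mem Ls)
    ultimately have "nrm (?e + - ?e) = max (nrm ?e) (nrm (- ?e))"
      by (rule mx)
    moreover have "nrm (?e + - ?e) \<le> 0"
      by (simp only: pos(2) right_minus)
    ultimately have "nrm ?e \<le> 0"
      by simp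
    then show "?u (L d) = L (?u d)" "?s (L d) = L (?s d)"
      using e by (simp_all add: pos(2))
  qed
  show "nrm (L (?s d)) \<le> b * nrm (?s d)"
  proof (cases "?s d = 0")
    case False
    then have p: "nrm (?s d) > 0"
      using pos(2)[of "?s d"] by linarith
    have "ennreal (nrm (L (?s d)) / nrm (?s d)) \<le> ennreal b"
      using ops mem(1)[of d] unfolding op_norm_on_def by (simp add: SUP_le_iff)
    then show ?thesis
      using p b by (simp add: pos_divide_le_eq)
  qed (use pos(2)[of 0] in \<open>simp add: linear_0[OF lin] antisym[OF _ pos(1)]\<close>)
  show "a * nrm (?u d) \<le> nrm (L (?u d))"
  proof -
    have inj: "inj_on L (unstable_space L)"
      using a specu by (intro inj_on_of_zero_notin_spectrum_on[OF subu]) auto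
    then have inv: "inv_into (unstable_space L) L (L (?u d)) = ?u d"
      using mem by (intro inv_into_f_f)
    show ?thesis
    proof (cases "L (?u d) = 0")
      case True
      then have "?u d = 0"
        using inj_onD[OF inj _ mem(2)[of d] subspace_0[OF subu]] by (simp add: linear_0[OF lin])
      moreover have "nrm 0 = 0"
        using pos(2)[of 0] pos(1)[of 0] by simp
      ultimately show ?thesis
        by (simp add: linear_0[OF lin])
    next
      case False
      then have p: "nrm (L (?u d)) > 0"
        using pos(2)[of "L (?u d)"] by linarith
      have "ennreal (nrm (inv_into (unstable_space L) L (L (?u d))) / nrm (L (?u d))) \<le> ennreal (1 / a)"
        using opu Lu[OF mem(2)[of d]] unfolding op_norm_on_def by (simp add: SUP_le_iff)
      then have "nrm (?u d) / nrm (L (?u d)) \<le> 1 / a"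
        using a by (simp add: inv)
      then show ?thesis
        using p a by (simp add: field_simps)
    qed
  qed
qed

section \<open>Cones and synchronization of orbits\<close>

lemma geometric_decay_int:
  fixes f :: "int \<Rightarrow> real"
  assumes q: "0 \<le> q" "q < 1" and f: "\<And>m. m \<ge> m0 \<Longrightarrow> 0 \<le> f m" "\<And>m. m \<ge> m0 \<Longrightarrow> f (m + 1) \<le> q * f m"
  shows "(f \<longlongrightarrow> 0) at_top"
proof (rule tendstoI)
  fix e :: real assume "e > 0"
  have pow: "f (m0 + int n) \<le> q ^ n * f m0" for n
  proof (induction n)
    case (Suc n)
    have "f (m0 + int (Suc n)) \<le> q * f (m0 + int n)"
      using f(2)[of "m0 + int n"] by (simp add: algebra_simps)
    also have "\<dots> \<le> q * (q ^ n * f m0)"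
      using Suc.IH q(1) by (rule mult_left_mono)
    finally show ?case by simp
  qed simp
  have "(\<lambda>n. q ^ n * f m0) \<longlonglongrightarrow> 0 * f m0"
    using q by (intro tendsto_mult_right LIMSEQ_realpow_zero)
  then have "eventually (\<lambda>n. q ^ n * f m0 < e) sequentially"
    using \<open>e > 0\<close> by (intro order_tendstoD(2)[of _ 0]) auto
  then obtain n0 where n0: "\<And>n. n \<ge> n0 \<Longrightarrow> q ^ n * f m0 < e"
    by (auto simp: eventually_sequentially)
  have "dist (f m) 0 < e" if "m \<ge> m0 + int n0" for m
  proof -
    have m: "m = m0 + int (nat (m - m0))" "nat (m - m0) \<ge> n0"
      using that by auto
    then have "f m < e"
      using pow[of "nat (m - m0)"] n0[OF m(2)] by simp
    then show ?thesis
      using f(1)[of m] that by simp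
  qed
  then show "eventually (\<lambda>m. dist (f m) 0 < e) at_top"
    unfolding eventually_at_top_linorder by blast
qed

text \<open>
  The sizes \<open>pu d\<close> and \<open>ps d\<close> stand for the unstable and the stable component of \<open>d\<close>. The second
  half of \<open>unstable_cone\<close> makes the unstable cone invariant, since \<open>\<mu> < \<kappa>\<close>.
\<close>

locale cone_hyperbolic =
  fixes B :: "'a::real_normed_vector set" and S :: "'a \<Rightarrow> 'a"
    and pu ps :: "'a \<Rightarrow> real" and \<kappa> \<mu> :: real
  assumes bounded_B: "bounded B"
    and rates: "1 < \<kappa>" "0 \<le> \<mu>" "\<mu> < 1"
    and nonneg: "0 \<le> pu d" "0 \<le> ps d"
    and equivalent: "\<exists>c>0. \<exists>C. \<forall>d. c * norm d \<le> max (pu d) (ps d) \<and> max (pu d) (ps d) \<le> C * norm d"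
    and unstable_cone: "x \<in> B \<Longrightarrow> y \<in> B \<Longrightarrow> ps (x - y) \<le> pu (x - y) \<Longrightarrow>
      \<kappa> * pu (x - y) \<le> pu (S x - S y) \<and> ps (S x - S y) \<le> \<mu> * pu (x - y)"
    and stable_cone: "x \<in> B \<Longrightarrow> y \<in> B \<Longrightarrow> pu (x - y) \<le> ps (x - y) \<Longrightarrow>
      ps (S x - S y) \<le> \<mu> * ps (x - y)"
begin

lemma bounded_components: "\<exists>M>0. \<forall>x\<in>B. \<forall>y\<in>B. pu (x - y) \<le> M \<and> ps (x - y) \<le> M"
proof -
  obtain C where C: "\<And>d. max (pu d) (ps d) \<le> C * norm d"
    using equivalent by blast
  obtain D where D: "\<And>x. x \<in> B \<Longrightarrow> norm x \<le> D" "D > 0"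
    using bounded_B by (auto simp: bounded_pos)
  have "max (pu (x - y)) (ps (x - y)) \<le> \<bar>C\<bar> * (2 * D) + 1" if "x \<in> B" "y \<in> B" for x y
  proof -
    have "norm (x - y) \<le> 2 * D"
      using norm_triangle_ineq4[of x y] D(1)[OF that(1)] D(1)[OF that(2)] by simp
    then have "C * norm (x - y) \<le> \<bar>C\<bar> * (2 * D)"
      by (intro mult_mono) auto
    then show ?thesis
      using C[of "x - y"] by linarith
  qed
  moreover have "\<bar>C\<bar> * (2 * D) + 1 > 0"
    using D(2) by (intro add_nonneg_pos mult_nonneg_nonneg) auto
  ultimately show ?thesis
    by (intro exI[of _ "\<bar>C\<bar> * (2 * D) + 1"]) auto
qed

text \<open>
  Once in the interior of the unstable cone, the difference stays in the cone and grows like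
  \<open>\<kappa> ^ n\<close>, which the bounded set \<open>B\<close> does not allow.
\<close>

lemma forward_orbits_in_stable_cone:
  assumes B: "\<And>n. u n \<in> B" "\<And>n. v n \<in> B" and orb: "\<And>n. S (u n) = u (Suc n)" "\<And>n. S (v n) = v (Suc n)"
  shows "pu (u 0 - v 0) \<le> ps (u 0 - v 0)"
proof (rule ccontr)
  assume neg: "\<not> ?thesis"
  let ?d = "\<lambda>n. u n - v n"
  have grow: "ps (?d n) \<le> pu (?d n) \<and> \<kappa> ^ n * pu (?d 0) \<le> pu (?d n)" for n
  proof (induction n)
    case (Suc n)
    have step: "\<kappa> * pu (?d n) \<le> pu (?d (Suc n))" "ps (?d (Suc n)) \<le> \<mu> * pu (?d n)"
      using unstable_cone[OF B, of n n] Suc.IH by (auto simp: orb)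
    have "\<kappa> * (\<kappa> ^ n * pu (?d 0)) \<le> \<kappa> * pu (?d n)"
      using Suc.IH rates by (intro mult_left_mono) auto
    moreover have "\<mu> * pu (?d n) \<le> \<kappa> * pu (?d n)"
      using rates nonneg by (intro mult_right_mono) auto
    ultimately show ?case
      using step by auto
  qed (use neg in auto)
  obtain M where M: "M > 0" "\<And>x y. x \<in> B \<Longrightarrow> y \<in> B \<Longrightarrow> pu (x - y) \<le> M"
    using bounded_components by blast
  have p: "pu (?d 0) > 0"
    using neg nonneg(2)[of "?d 0"] by linarith
  obtain n where "M / pu (?d 0) < \<kappa> ^ n"
    using real_arch_pow[OF rates(1)] by blast
  then show False
    using grow[of n] M(2)[OF B, of n n] p by (simp add: field_simps)
qed

text \<open>
  By invariance of the unstable cone a difference outside it has all its predecessors outside; these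
  grow like \<open>\<mu> ^ (- n)\<close> backward in time.
\<close>

lemma backward_orbits_in_unstable_cone:
  assumes B: "\<And>n. u n \<in> B" "\<And>n. v n \<in> B" and orb: "\<And>n. S (u (Suc n)) = u n" "\<And>n. S (v (Suc n)) = v n"
  shows "ps (u 0 - v 0) \<le> pu (u 0 - v 0)"
proof (rule ccontr)
  assume neg: "\<not> ?thesis"
  let ?d = "\<lambda>n. u n - v n"
  have shrink: "pu (?d n) < ps (?d n) \<and> ps (?d 0) \<le> \<mu> ^ n * ps (?d n)" for n
  proof (induction n)
    case (Suc n)
    have less: "pu (?d (Suc n)) < ps (?d (Suc n))"
    proof (rule ccontr)
      assume "\<not> ?thesis"
      then have "\<kappa> * pu (?d (Suc n)) \<le> pu (?d n)" "ps (?d n) \<le> \<mu> * pu (?d (Suc n))"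
        using unstable_cone[OF B, of "Suc n" "Suc n"] by (auto simp: orb)
      moreover have "\<mu> * pu (?d (Suc n)) \<le> \<kappa> * pu (?d (Suc n))"
        using rates nonneg by (intro mult_right_mono) auto
      ultimately show False
        using Suc.IH by simp
    qed
    then have "ps (?d n) \<le> \<mu> * ps (?d (Suc n))"
      using stable_cone[OF B, of "Suc n" "Suc n"] by (simp add: orb)
    then have "\<mu> ^ n * ps (?d n) \<le> \<mu> ^ n * (\<mu> * ps (?d (Suc n)))"
      using rates by (intro mult_left_mono) auto
    then show ?case
      using less Suc.IH by (simp add: algebra_simps)
  qed (use neg in auto)
  obtain M where M: "M > 0" "\<And>x y. x \<in> B \<Longrightarrow> y \<in> B \<Longrightarrow> ps (x - y) \<le> M"
    using bounded_components by blast
  have p: "ps (?d 0) > 0"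
    using neg nonneg(1)[of "?d 0"] by linarith
  obtain n where n: "\<mu> ^ n < ps (?d 0) / M"
    using real_arch_pow_inv[OF divide_pos_pos[OF p M(1)] rates(3)] by blast
  have "ps (?d 0) \<le> \<mu> ^ n * M"
    using shrink[of n] M(2)[OF B, of n n] rates(2) by (meson mult_left_mono order_trans zero_le_power)
  then show False
    using n M(1) by (simp add: field_simps)
qed

lemma dist_tendsto_0I:
  assumes "((\<lambda>m. max (pu (\<xi> m - \<zeta> m)) (ps (\<xi> m - \<zeta> m))) \<longlongrightarrow> 0) F"
  shows "((\<lambda>m. dist (\<xi> m) (\<zeta> m)) \<longlongrightarrow> 0) F"
proof -
  obtain c where c: "c > 0" "\<And>d. c * norm d \<le> max (pu d) (ps d)"
    using equivalent by blast
  let ?g = "\<lambda>m. max (pu (\<xi> m - \<zeta> m)) (ps (\<xi> m - \<zeta> m))"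
  have lim: "((\<lambda>m. ?g m / c) \<longlongrightarrow> 0) F"
    using tendsto_divide[OF assms tendsto_const[of c]] c(1) by simp
  have "norm (dist (\<xi> m) (\<zeta> m)) \<le> ?g m / c" for m
    using c(2)[of "\<xi> m - \<zeta> m"] c(1) by (simp add: dist_norm pos_le_divide_eq mult.commute)
  then have "eventually (\<lambda>m. norm (dist (\<xi> m) (\<zeta> m)) \<le> ?g m / c) F"
    by (simp add: always_eventually)
  then show ?thesis
    using lim by (rule Lim_null_comparison)
qed

lemma solutions_stable_cone:
  assumes sol: "global_solution S \<xi>" "global_solution S \<zeta>"
    and B: "\<And>m. m \<ge> m0 \<Longrightarrow> \<xi> m \<in> B" "\<And>m. m \<ge> m0 \<Longrightarrow> \<zeta> m \<in> B" and "m \<ge> m0"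
  shows "pu (\<xi> m - \<zeta> m) \<le> ps (\<xi> m - \<zeta> m)"
  using forward_orbits_in_stable_cone[of "\<lambda>n. \<xi> (m + int n)" "\<lambda>n. \<zeta> (m + int n)"] assms
  by (auto simp: global_solution_def algebra_simps)

lemma solutions_unstable_cone:
  assumes sol: "global_solution S \<xi>" "global_solution S \<zeta>"
    and B: "\<And>m. m \<le> m0 \<Longrightarrow> \<xi> m \<in> B" "\<And>m. m \<le> m0 \<Longrightarrow> \<zeta> m \<in> B" and "m \<le> m0"
  shows "ps (\<xi> m - \<zeta> m) \<le> pu (\<xi> m - \<zeta> m)"
  using backward_orbits_in_unstable_cone[of "\<lambda>n. \<xi> (m - int n)" "\<lambda>n. \<zeta> (m - int n)"] assms
  by (auto simp: global_solution_def algebra_simps)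

lemma forward_asymptotic:
  assumes sol: "global_solution S \<xi>" "global_solution S \<zeta>"
    and B: "\<And>m. m \<ge> m0 \<Longrightarrow> \<xi> m \<in> B" "\<And>m. m \<ge> m0 \<Longrightarrow> \<zeta> m \<in> B"
  shows "((\<lambda>m. dist (\<xi> m) (\<zeta> m)) \<longlongrightarrow> 0) at_top"
proof (rule dist_tendsto_0I)
  let ?ps = "\<lambda>m. ps (\<xi> m - \<zeta> m)"
  have cone: "pu (\<xi> m - \<zeta> m) \<le> ?ps m" if "m \<ge> m0" for m
    using solutions_stable_cone[OF sol, of m0 m] B that by blast
  have "(?ps \<longlongrightarrow> 0) at_top"
  proof (rule geometric_decay_int[of \<mu> m0])
    show "?ps (m + 1) \<le> \<mu> * ?ps m" if "m \<ge> m0" for m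
      using stable_cone[OF B(1)[OF that] B(2)[OF that] cone[OF that]] sol by (simp add: global_solution_def)
  qed (use rates nonneg in auto)
  moreover have "eventually (\<lambda>m. ?ps m = max (pu (\<xi> m - \<zeta> m)) (?ps m)) at_top"
    using eventually_ge_at_top[of m0] by eventually_elim (simp add: cone max_absorb2)
  ultimately show "((\<lambda>m. max (pu (\<xi> m - \<zeta> m)) (?ps m)) \<longlongrightarrow> 0) at_top"
    by (rule Lim_transform_eventually)
qed

lemma backward_asymptotic:
  assumes sol: "global_solution S \<xi>" "global_solution S \<zeta>"
    and B: "\<And>m. m \<le> m0 \<Longrightarrow> \<xi> m \<in> B" "\<And>m. m \<le> m0 \<Longrightarrow> \<zeta> m \<in> B"
  shows "((\<lambda>m. dist (\<xi> m) (\<zeta> m)) \<longlongrightarrow> 0) at_bot"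
proof (rule dist_tendsto_0I)
  let ?pu = "\<lambda>m. pu (\<xi> m - \<zeta> m)"
  have cone: "ps (\<xi> m - \<zeta> m) \<le> ?pu m" if "m \<le> m0" for m
    using solutions_unstable_cone[OF sol, of m0 m] B that by blast
  have "((\<lambda>m. ?pu (- m)) \<longlongrightarrow> 0) at_top"
  proof (rule geometric_decay_int[of "1 / \<kappa>" "- m0"])
    fix m assume "m \<ge> - m0"
    then have "- (m + 1) \<le> m0" by simp
    from unstable_cone[OF B(1)[OF this] B(2)[OF this] cone[OF this]]
    have "\<kappa> * ?pu (- (m + 1)) \<le> ?pu (- (m + 1) + 1)"
      using sol unfolding global_solution_def by metis
    then show "?pu (- (m + 1)) \<le> 1 / \<kappa> * ?pu (- m)"
      using rates by (simp add: field_simps)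
  qed (use rates nonneg in auto)
  then have "(?pu \<longlongrightarrow> 0) at_bot"
    by (simp add: at_bot_mirror filterlim_filtermap)
  moreover have "eventually (\<lambda>m. ?pu m = max (?pu m) (ps (\<xi> m - \<zeta> m))) at_bot"
    using eventually_le_at_bot[of m0] by eventually_elim (simp add: cone max_absorb1)
  ultimately show "((\<lambda>m. max (?pu m) (ps (\<xi> m - \<zeta> m))) \<longlongrightarrow> 0) at_bot"
    by (rule Lim_transform_eventually)
qed

text \<open>
  The difference lies in both cones at all times, so its two components have equal size; this common
  size would have to grow by \<open>\<kappa>\<close> and shrink by \<open>\<mu>\<close> in one step.
\<close>

lemma solutions_equal:
  assumes sol: "global_solution S \<xi>" "global_solution S \<zeta>" and B: "range \<xi> \<subseteq> B" "range \<zeta> \<subseteq> B"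
  shows "\<xi> = \<zeta>"
proof
  fix m
  have in_B: "\<xi> k \<in> B" "\<zeta> k \<in> B" for k
    using B by auto
  have eq: "pu (\<xi> k - \<zeta> k) = ps (\<xi> k - \<zeta> k)" for k
    using solutions_stable_cone[OF sol, of k k] solutions_unstable_cone[OF sol, of k k] in_B
    by (intro antisym) auto
  have "\<kappa> * pu (\<xi> m - \<zeta> m) \<le> pu (\<xi> (m + 1) - \<zeta> (m + 1))"
    "ps (\<xi> (m + 1) - \<zeta> (m + 1)) \<le> \<mu> * pu (\<xi> m - \<zeta> m)"
    using unstable_cone[OF in_B, of m m] sol by (simp_all add: eq global_solution_def)
  then have "\<kappa> * pu (\<xi> m - \<zeta> m) \<le> \<mu> * pu (\<xi> m - \<zeta> m)"
    by (simp add: eq)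
  then have "pu (\<xi> m - \<zeta> m) = 0"
    using rates nonneg(1)[of "\<xi> m - \<zeta> m"] by (auto simp: mult_le_cancel_right)
  moreover obtain c where "c > 0" "c * norm (\<xi> m - \<zeta> m) \<le> max (pu (\<xi> m - \<zeta> m)) (ps (\<xi> m - \<zeta> m))"
    using equivalent by blast
  ultimately show "\<xi> m = \<zeta> m"
    by (simp add: mult_le_0_iff flip: eq)
qed

end

text \<open>
  The consequences of the cone alternative that can be stated in a metric space. The global argument
  uses nothing else about hyperbolicity.
\<close>

definition synchronizing_on :: "'a::metric_space set \<Rightarrow> ('a \<Rightarrow> 'a) \<Rightarrow> bool" where
  "synchronizing_on B S \<longleftrightarrow>
     (\<forall>\<xi> \<zeta>. global_solution S \<xi> \<and> global_solution S \<zeta> \<longrightarrow>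
        (range \<xi> \<subseteq> B \<and> range \<zeta> \<subseteq> B \<longrightarrow> \<xi> = \<zeta>) \<and>
        (eventually (\<lambda>m. \<xi> m \<in> B \<and> \<zeta> m \<in> B) at_top \<longrightarrow> ((\<lambda>m. dist (\<xi> m) (\<zeta> m)) \<longlongrightarrow> 0) at_top) \<and>
        (eventually (\<lambda>m. \<xi> m \<in> B \<and> \<zeta> m \<in> B) at_bot \<longrightarrow> ((\<lambda>m. dist (\<xi> m) (\<zeta> m)) \<longlongrightarrow> 0) at_bot))"

lemma synchronizing_onD:
  assumes "synchronizing_on B S" "global_solution S \<xi>" "global_solution S \<zeta>"
  shows "range \<xi> \<subseteq> B \<Longrightarrow> range \<zeta> \<subseteq> B \<Longrightarrow> \<xi> = \<zeta>"
    "eventually (\<lambda>m. \<xi> m \<in> B) at_top \<Longrightarrow> eventually (\<lambda>m. \<zeta> m \<in> B) at_top \<Longrightarrow>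
      ((\<lambda>m. dist (\<xi> m) (\<zeta> m)) \<longlongrightarrow> 0) at_top"
    "eventually (\<lambda>m. \<xi> m \<in> B) at_bot \<Longrightarrow> eventually (\<lambda>m. \<zeta> m \<in> B) at_bot \<Longrightarrow>
      ((\<lambda>m. dist (\<xi> m) (\<zeta> m)) \<longlongrightarrow> 0) at_bot"
  using assms unfolding synchronizing_on_def eventually_conj_iff by simp_all

lemma (in cone_hyperbolic) synchronizing: "synchronizing_on B S"
  unfolding synchronizing_on_def eventually_at_top_linorder eventually_at_bot_linorder
  using solutions_equal forward_asymptotic backward_asymptotic by blast

text \<open>
  The difference of images is \<open>L d\<close> plus a remainder of size at most \<open>(\<gamma> + e) nrm d\<close>, where \<open>e\<close>
  comes from the perturbation. In the maximum norm \<open>nrm d\<close> is the size of the dominating component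
  of \<open>d\<close>: a dominating unstable component is multiplied by at least \<open>a - (\<gamma> + e)\<close>, a dominating
  stable one by at most \<open>b + (\<gamma> + e)\<close>.
  The statement is uniform in the map \<open>S\<close> and in the subset \<open>B\<close> of the ball, so that the ball can
  be chosen before \<open>\<eta>\<close>.
\<close>

lemma weakly_hyperbolic_imp_synchronizing:
  fixes T :: "'a::banach \<Rightarrow> 'a"
  assumes "weakly_hyperbolic_decomposition T x0 L N a b nrm \<gamma>"
  shows "\<exists>r>0. \<exists>\<epsilon>>0. \<forall>B S. B \<subseteq> ball x0 r \<and>
      (\<forall>x\<in>B. \<forall>y\<in>B. norm ((S x - T x) - (S y - T y)) \<le> \<epsilon> * norm (x - y)) \<longrightarrow>
      synchronizing_on B S"
proof -
  let ?s = "stable_proj L" and ?u = "unstable_proj L"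
  have T: "\<And>x. T (x + x0) - x0 = L x + N x"
    and hyp: "hyperbolic_operator L a b nrm"
    and gap: "b + 2 * \<gamma> < 1" "1 < a - 2 * \<gamma>" and "\<gamma> > 0"
    and U0: "\<exists>U0. 0 \<in> interior U0 \<and> (\<forall>x\<in>U0. \<forall>y\<in>U0. nrm (N x - N y) \<le> \<gamma> * nrm (x - y))"
    using assms unfolding weakly_hyperbolic_decomposition_def by auto
  obtain U0 where U0: "0 \<in> interior U0" "\<And>x y. x \<in> U0 \<Longrightarrow> y \<in> U0 \<Longrightarrow> nrm (N x - N y) \<le> \<gamma> * nrm (x - y)"
    using U0 by blast
  obtain r where r: "r > 0" "ball 0 r \<subseteq> U0"
    using U0(1) by (auto simp: mem_interior)
  have "b > 0" and lin: "linear L" and nrm: "equivalent_norm nrm"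
    using hyp by (auto simp: hyperbolic_operator_def bounded_linear.linear)
  note split = hyperbolic_operator_splitting[OF hyp]
  have tri: "nrm (x + y) \<le> nrm x + nrm y" for x y
    using nrm by (simp add: equivalent_norm_def)
  have neg: "nrm (- x) = nrm x" for x
  proof -
    have "nrm ((- 1) *\<^sub>R x) = \<bar>- 1\<bar> * nrm x"
      using nrm unfolding equivalent_norm_def by blast
    then show ?thesis by simp
  qed
  obtain c C where c: "c > 0" "C > 0" "\<And>x. c * norm x \<le> nrm x" "\<And>x. nrm x \<le> C * norm x"
    using nrm unfolding equivalent_norm_def by blast
  have pos: "0 \<le> nrm x" for x
    using c(1) by (intro order_trans[OF _ c(3)]) auto
  \<comment> \<open>any \<open>e\<close> with \<open>b + (\<gamma> + e) < 1 < a - (\<gamma> + e)\<close> serves\<close>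
  define e where "e = min (1 - b - 2 * \<gamma>) (a - 2 * \<gamma> - 1) / 4"
  have e: "e > 0" "b + (\<gamma> + e) < 1" "1 < a - (\<gamma> + e)"
    using gap \<open>\<gamma> > 0\<close> by (auto simp: e_def min_def field_simps)
  have cone: "cone_hyperbolic B S (\<lambda>d. nrm (?u d)) (\<lambda>d. nrm (?s d)) (a - (\<gamma> + e)) (b + (\<gamma> + e))"
    if B: "B \<subseteq> ball x0 r"
      and S: "\<forall>x\<in>B. \<forall>y\<in>B. norm ((S x - T x) - (S y - T y)) \<le> e * c / C * norm (x - y)" for B S
  proof -
    have step: "nrm (?u (S x - S y)) \<ge> a * nrm (?u (x - y)) - (\<gamma> + e) * nrm (x - y)"
      "nrm (?s (S x - S y)) \<le> b * nrm (?s (x - y)) + (\<gamma> + e) * nrm (x - y)"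
      if "x \<in> B" "y \<in> B" for x y
    proof -
      let ?d = "x - y"
      let ?P = "(S x - T x) - (S y - T y)" and ?Q = "N (x - x0) - N (y - x0)"
      let ?R = "?Q + ?P"
      have "nrm ?Q \<le> \<gamma> * nrm ?d"
      proof -
        have "x - x0 \<in> U0" "y - x0 \<in> U0"
          using that B r(2) by (auto simp: subset_iff dist_norm norm_minus_commute)
        then show ?thesis
          using U0(2)[of "x - x0" "y - x0"] by simp
      qed
      moreover have "nrm ?P \<le> e * nrm ?d"
      proof -
        have "nrm ?P \<le> C * (e * c / C * norm ?d)"
          using c(2) S that by (intro order_trans[OF c(4)] mult_left_mono) auto
        also have "\<dots> = e * (c * norm ?d)"
          using c(2) by simp
        also have "\<dots> \<le> e * nrm ?d"
          using e(1) c(3) by (intro mult_left_mono) auto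
        finally show ?thesis .
      qed
      ultimately have R: "nrm ?R \<le> (\<gamma> + e) * nrm ?d"
        using tri[of ?Q ?P] by (simp add: algebra_simps)
      have eq: "S x - S y = L ?d + ?R"
      proof -
        have "T z = L z - L x0 + N (z - x0) + x0" for z
          using T[of "z - x0"] by (simp add: linear_diff[OF lin] algebra_simps)
        then show ?thesis
          by (simp add: linear_diff[OF lin])
      qed
      have Ru: "nrm (?u ?R) \<le> nrm ?R" and Rs: "nrm (?s ?R) \<le> nrm ?R"
        using split(3)[of ?R] by auto
      have "nrm (L (?u ?d)) \<le> nrm (?u (S x - S y)) + nrm (- ?u ?R)"
        using tri[of "?u (S x - S y)" "- ?u ?R"] unfolding eq
        by (simp add: linear_add[OF split(2)] split(4))
      then show "nrm (?u (S x - S y)) \<ge> a * nrm (?u ?d) - (\<gamma> + e) * nrm ?d"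
        using split(7)[of ?d] Ru R by (simp add: neg)
      have "nrm (?s (S x - S y)) \<le> nrm (L (?s ?d)) + nrm (?s ?R)"
        using tri unfolding eq by (simp add: linear_add[OF split(1)] split(5))
      then show "nrm (?s (S x - S y)) \<le> b * nrm (?s ?d) + (\<gamma> + e) * nrm ?d"
        using split(6)[of ?d] Rs R by simp
    qed
    show ?thesis
    proof
      show "bounded B"
        using B bounded_ball bounded_subset by blast
      show "\<exists>c>0. \<exists>C. \<forall>d. c * norm d \<le> max (nrm (?u d)) (nrm (?s d)) \<and> max (nrm (?u d)) (nrm (?s d)) \<le> C * norm d"
        using c by (auto simp flip: split(3))
      fix x y assume xy: "x \<in> B" "y \<in> B"
      show "(a - (\<gamma> + e)) * nrm (?u (x - y)) \<le> nrm (?u (S x - S y)) \<and>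
          nrm (?s (S x - S y)) \<le> (b + (\<gamma> + e)) * nrm (?u (x - y))"
        if le: "nrm (?s (x - y)) \<le> nrm (?u (x - y))"
      proof -
        have "nrm (x - y) = nrm (?u (x - y))"
          using split(3)[of "x - y"] le by simp
        moreover have "b * nrm (?s (x - y)) \<le> b * nrm (?u (x - y))"
          using le \<open>b > 0\<close> by simp
        ultimately show ?thesis
          using step[OF xy] by (simp add: algebra_simps)
      qed
      show "nrm (?s (S x - S y)) \<le> (b + (\<gamma> + e)) * nrm (?s (x - y))"
        if le: "nrm (?u (x - y)) \<le> nrm (?s (x - y))"
      proof -
        have "nrm (x - y) = nrm (?s (x - y))"
          using split(3)[of "x - y"] le by simp
        then show ?thesis
          using step(2)[OF xy] by (simp add: algebra_simps)
      qed
    qed (use e \<open>b > 0\<close> \<open>\<gamma> > 0\<close> pos in auto)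
  qed
  moreover have "e * c / C > 0"
    using e c by simp
  ultimately show ?thesis
    using r(1) by (intro exI[of _ r] exI[of _ "e * c / C"] conjI allI impI)
      (auto intro: cone_hyperbolic.synchronizing)
qed

section \<open>Limits of pseudo-orbits\<close>

text \<open>
  Solutions of all the maps \<open>T \<eta>\<close> are treated at once as perturbed orbits of the single map \<open>T 0\<close>.
\<close>

definition pseudo_orbit :: "('a::metric_space \<Rightarrow> 'a) \<Rightarrow> real \<Rightarrow> (int \<Rightarrow> 'a) \<Rightarrow> bool" where
  "pseudo_orbit f \<delta> \<xi> \<longleftrightarrow> (\<forall>m. dist (f (\<xi> m)) (\<xi> (m + 1)) < \<delta>)"

lemma pseudo_orbit_mono: "pseudo_orbit f \<delta> \<xi> \<Longrightarrow> \<delta> \<le> \<delta>' \<Longrightarrow> pseudo_orbit f \<delta>' \<xi>"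
  unfolding pseudo_orbit_def by (meson order_less_le_trans)

lemma pseudo_orbit_shift: "pseudo_orbit f \<delta> \<xi> \<Longrightarrow> pseudo_orbit f \<delta> (\<lambda>m. \<xi> (m + a))"
  unfolding pseudo_orbit_def by (metis add.assoc add.commute)

lemma compact_functions_into:
  fixes K :: "'a::topological_space set"
  assumes "compact K"
  shows "compact {\<xi> :: 'i \<Rightarrow> 'a. range \<xi> \<subseteq> K}"
proof -
  have "compactin (product_topology (\<lambda>i. euclidean) UNIV) (PiE UNIV (\<lambda>i::'i. K))"
    using assms by (simp add: compactin_PiE)
  moreover have "PiE UNIV (\<lambda>i::'i. K) = {\<xi>. range \<xi> \<subseteq> K}"
    by (auto simp: PiE_def Pi_def)
  ultimately show ?thesis
    by (simp add: euclidean_product_topology)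
qed

text \<open>
  The sequences in \<open>K\<close> indexed by the integers form a compact metrizable space under pointwise
  convergence.
\<close>

lemma pseudo_orbits_subsequence:
  fixes f :: "'a::metric_space \<Rightarrow> 'a"
  assumes K: "compact K" and f: "continuous_on K f"
    and \<xi>: "\<And>k. range (\<xi> k) \<subseteq> K" "\<And>k. pseudo_orbit f (\<delta> k) (\<xi> k)" and \<delta>: "\<delta> \<longlonglongrightarrow> 0"
  obtains s \<zeta> where "strict_mono (s :: nat \<Rightarrow> nat)" "global_solution f \<zeta>" "range \<zeta> \<subseteq> K"
    "\<And>m. (\<lambda>k. \<xi> (s k) m) \<longlonglongrightarrow> \<zeta> m"
proof -
  have "seq_compact {\<xi> :: int \<Rightarrow> 'a. range \<xi> \<subseteq> K}"
    using compact_functions_into[OF K] by (rule compact_imp_seq_compact)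
  then obtain \<zeta> s where \<zeta>: "range \<zeta> \<subseteq> K" and s: "strict_mono (s :: nat \<Rightarrow> nat)" and lim: "(\<xi> \<circ> s) \<longlonglongrightarrow> \<zeta>"
    using \<xi>(1) unfolding seq_compact_def by (metis (mono_tags, lifting) mem_Collect_eq)
  have pt: "(\<lambda>k. \<xi> (s k) m) \<longlonglongrightarrow> \<zeta> m" for m
  proof -
    have "continuous_on UNIV (\<lambda>\<xi> :: int \<Rightarrow> 'a. \<xi> m)"
      by (rule continuous_on_product_coordinates)
    then have "isCont (\<lambda>\<xi> :: int \<Rightarrow> 'a. \<xi> m) \<zeta>"
      by (simp add: continuous_on_eq_continuous_within)
    from isCont_tendsto_compose[OF this lim] show ?thesis
      by (simp add: o_def)
  qed
  have "f (\<zeta> m) = \<zeta> (m + 1)" for m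
  proof -
    have "(\<lambda>k. f (\<xi> (s k) m)) \<longlonglongrightarrow> f (\<zeta> m)"
      using \<zeta> \<xi>(1) by (intro continuous_on_tendsto_compose[OF f pt]) (blast intro: always_eventually)+
    then have "(\<lambda>k. dist (f (\<xi> (s k) m)) (\<xi> (s k) (m + 1))) \<longlonglongrightarrow> dist (f (\<zeta> m)) (\<zeta> (m + 1))"
      by (intro tendsto_dist pt)
    moreover have "(\<lambda>k. dist (f (\<xi> (s k) m)) (\<xi> (s k) (m + 1))) \<longlonglongrightarrow> 0"
    proof (rule Lim_null_comparison)
      show "eventually (\<lambda>k. norm (dist (f (\<xi> (s k) m)) (\<xi> (s k) (m + 1))) \<le> \<delta> (s k)) sequentially"
        using \<xi>(2) by (intro always_eventually) (auto simp: pseudo_orbit_def intro: less_imp_le)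
      show "(\<lambda>k. \<delta> (s k)) \<longlonglongrightarrow> 0"
        using LIMSEQ_subseq_LIMSEQ[OF \<delta> s] by (simp add: o_def)
    qed
    ultimately have "dist (f (\<zeta> m)) (\<zeta> (m + 1)) = 0"
      using LIMSEQ_unique by blast
    then show ?thesis by simp
  qed
  then show ?thesis
    using that s \<zeta> pt by (auto simp: global_solution_def)
qed

text \<open>
  One value of \<open>e\<close> in \<open>I\<close> occurs infinitely often. When \<open>y\<close> is an equilibrium and \<open>\<zeta>\<close> is a
  solution that does not come to rest there, the lemma forces the times \<open>e k\<close> to leave every finite set.
\<close>

lemma limit_hits:
  fixes \<xi> :: "nat \<Rightarrow> int \<Rightarrow> 'a::metric_space"
  assumes lim: "\<And>m. (\<lambda>k. \<xi> k m) \<longlonglongrightarrow> \<zeta> m" and fin: "finite I"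
    and freq: "frequently (\<lambda>k. e k \<in> I) sequentially"
    and y: "(\<lambda>k. \<xi> k (e k)) \<longlonglongrightarrow> y"
  shows "\<exists>m\<in>I. \<zeta> m = y"
proof -
  have "\<exists>m\<in>I. frequently (\<lambda>k. e k = m) sequentially"
  proof (rule ccontr)
    assume "\<not> ?thesis"
    then have "\<forall>m\<in>I. eventually (\<lambda>k. e k \<noteq> m) sequentially"
      by (auto simp: frequently_def)
    then have "eventually (\<lambda>k. \<forall>m\<in>I. e k \<noteq> m) sequentially"
      using fin by (simp add: eventually_ball_finite)
    then have "eventually (\<lambda>k. e k \<notin> I) sequentially"
      by (rule eventually_mono) auto
    then show False
      using freq by (simp add: frequently_def)
  qed
  then obtain m where m: "m \<in> I" "frequently (\<lambda>k. e k = m) sequentially"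
    by blast
  have "\<zeta> m = y"
  proof (rule ccontr)
    assume "\<zeta> m \<noteq> y"
    have "(\<lambda>k. dist (\<xi> k m) (\<xi> k (e k))) \<longlonglongrightarrow> dist (\<zeta> m) y"
      by (intro tendsto_dist lim y)
    then have "eventually (\<lambda>k. dist (\<xi> k m) (\<xi> k (e k)) > 0) sequentially"
      using \<open>\<zeta> m \<noteq> y\<close> by (intro order_tendstoD(1)[of _ "dist (\<zeta> m) y"]) auto
    then have "eventually (\<lambda>k. e k \<noteq> m) sequentially"
      by eventually_elim auto
    then show False
      using m(2) by (simp add: frequently_def)
  qed
  then show ?thesis
    using m(1) by blast
qed

section \<open>Connections between equilibria\<close>

text \<open>
  A cycle of minimal length has no repeated vertex. Heteroclinic structures consist of distinct
  invariant sets, so only such cycles contradict their absence.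
\<close>

lemma minimal_cycle:
  assumes "(a, a) \<in> R\<^sup>+"
  obtains n g where "0 < (n::nat)" "inj_on g {..<n}" "g n = g 0" "\<And>m. m < n \<Longrightarrow> (g m, g (Suc m)) \<in> R"
proof -
  define P where "P n \<longleftrightarrow> n > 0 \<and> (\<exists>a. (a, a) \<in> R ^^ n)" for n
  have "\<exists>n. P n"
    using assms by (auto simp: P_def trancl_power)
  then have P: "P (LEAST n. P n)" and least: "\<And>n. P n \<Longrightarrow> (LEAST n. P n) \<le> n"
    by (auto intro: LeastI Least_le)
  define n where "n = (LEAST n. P n)"
  obtain g where g: "n > 0" "g n = g 0" "\<And>m. m < n \<Longrightarrow> (g m, g (Suc m)) \<in> R"
    using P by (auto simp: P_def relpow_fun_conv n_def)
  have ne: "g i \<noteq> g j" if "i < j" "j < n" for i j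
  proof
    assume eq: "g i = g j"
    have "\<exists>h. h 0 = g i \<and> h (j - i) = g i \<and> (\<forall>m<j - i. (h m, h (Suc m)) \<in> R)"
      using that eq g(3) by (intro exI[of _ "\<lambda>m. g (i + m)"]) auto
    then have "(g i, g i) \<in> R ^^ (j - i)"
      by (simp only: relpow_fun_conv)
    then have "P (j - i)"
      using that by (auto simp: P_def)
    from least[OF this] show False
      using that unfolding n_def[symmetric] by simp
  qed
  have "inj_on g {..<n}"
  proof (rule inj_onI)
    fix i j assume "i \<in> {..<n}" "j \<in> {..<n}" "g i = g j"
    then show "i = j"
      using ne[of i j] ne[of j i] by (cases i j rule: linorder_cases) auto
  qed
  then show ?thesis
    using that g by blast
qed

text \<open>
  The balls of radius \<open>r\<close> around the equilibria are even disjoint as closed balls, so a limit that is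
  known to lie in one of them determines the equilibrium.
\<close>

locale gradient_on_compact =
  fixes f :: "'a::metric_space \<Rightarrow> 'a" and K :: "'a set" and p :: nat and x :: "nat \<Rightarrow> 'a" and r :: real
  assumes compact_K: "compact K" and cont_f: "continuous_on K f"
    and fixed: "i \<in> {1..p} \<Longrightarrow> f (x i) = x i"
    and gradient: "dynamically_gradient f p (\<lambda>i. {x i})"
    and r_pos: "0 < r"
    and separated: "i \<in> {1..p} \<Longrightarrow> j \<in> {1..p} \<Longrightarrow> i \<noteq> j \<Longrightarrow> 2 * r < dist (x i) (x j)"
begin

definition connection :: "(nat \<times> nat) set" where
  "connection = {(i, j). i \<in> {1..p} \<and> j \<in> {1..p} \<and>
     (\<exists>\<xi>. global_solution f \<xi> \<and> bounded (range \<xi>) \<and> (\<forall>l\<in>{1..p}. \<not> range \<xi> \<subseteq> {x l}) \<and>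
        backward_to \<xi> {x i} \<and> forward_to \<xi> {x j})}"

lemma acyclic_connection: "acyclic connection"
proof (rule acyclicI, intro allI notI)
  fix i assume "(i, i) \<in> connection\<^sup>+"
  then obtain n g where n: "0 < n" "inj_on g {..<n}" "g n = g 0"
    and g: "\<And>m. m < n \<Longrightarrow> (g m, g (Suc m)) \<in> connection"
    by (rule minimal_cycle) blast
  \<comment> \<open>heteroclinic structures are indexed from 1\<close>
  define k where "k m = g (m - 1)" for m
  define conn where "conn i j \<xi> \<longleftrightarrow> global_solution f \<xi> \<and> bounded (range \<xi>) \<and>
      (\<forall>l\<in>{1..p}. \<not> range \<xi> \<subseteq> {x l}) \<and> backward_to \<xi> {x i} \<and> forward_to \<xi> {x j}" for i j \<xi>
  have k: "\<forall>m\<in>{1..n}. k m \<in> {1..p} \<and> (\<exists>\<xi>. conn (k m) (k (m + 1)) \<xi>)"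
  proof
    fix m assume "m \<in> {1..n}"
    then have "(k m, k (m + 1)) \<in> connection"
      using g[of "m - 1"] by (cases m) (auto simp: k_def)
    then show "k m \<in> {1..p} \<and> (\<exists>\<xi>. conn (k m) (k (m + 1)) \<xi>)"
      unfolding connection_def conn_def by blast
  qed
  then obtain \<xi> where \<xi>: "\<forall>m\<in>{1..n}. conn (k m) (k (m + 1)) (\<xi> m)"
    by metis
  have "inj_on k {1..n}"
  proof (rule inj_onI)
    fix a b assume "a \<in> {1..n}" "b \<in> {1..n}" "k a = k b"
    have "a - 1 = b - 1"
      by (rule inj_onD[OF n(2)]) (use \<open>a \<in> {1..n}\<close> \<open>b \<in> {1..n}\<close> \<open>k a = k b\<close> in \<open>auto simp: k_def\<close>)
    then show "a = b"
      using \<open>a \<in> {1..n}\<close> \<open>b \<in> {1..n}\<close> by (simp add: eq_diff_iff)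
  qed
  then have "heteroclinic_structure f p (\<lambda>i. {x i}) n k \<xi>"
    unfolding heteroclinic_structure_def using \<xi> k n by (simp add: k_def conn_def)
  then show False
    using gradient by (auto simp: dynamically_gradient_def)
qed

lemma finite_connection: "finite connection"
  by (rule finite_subset[of _ "{1..p} \<times> {1..p}"]) (auto simp: connection_def)

lemma dichotomy:
  assumes "global_solution f \<zeta>" "range \<zeta> \<subseteq> K"
  obtains i j where "i \<in> {1..p}" "j \<in> {1..p}"
    "((\<lambda>m. dist (\<zeta> m) (x i)) \<longlongrightarrow> 0) at_bot" "((\<lambda>m. dist (\<zeta> m) (x j)) \<longlongrightarrow> 0) at_top"
  using gradient assms bounded_subset[OF compact_imp_bounded[OF compact_K]]
  unfolding dynamically_gradient_def backward_to_def forward_to_def infdist_singleton by metis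

lemma solution_stays:
  assumes "global_solution f \<zeta>" "\<zeta> a = x i" "i \<in> {1..p}" "b \<ge> a"
  shows "\<zeta> b = x i"
  using \<open>b \<ge> a\<close>
proof (induction b rule: int_ge_induct)
  case (step b)
  then show ?case
    using assms fixed unfolding global_solution_def by metis
qed (use assms in simp)

text \<open>
  The pseudo-orbit is near \<open>x i\<close> at time \<open>a\<close>, outside the ball around it at time \<open>c\<close>, and near
  \<open>x j\<close> at time \<open>b\<close>. The intermediate time makes \<open>i = j\<close> meaningful.
\<close>

definition excursion :: "real \<Rightarrow> nat \<Rightarrow> nat \<Rightarrow> (int \<Rightarrow> 'a) \<Rightarrow> int \<Rightarrow> int \<Rightarrow> int \<Rightarrow> bool" where
  "excursion \<delta> i j \<xi> a c b \<longleftrightarrow> a \<le> c \<and> c \<le> b \<and>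
     dist (\<xi> a) (x i) < \<delta> \<and> r \<le> dist (\<xi> c) (x i) \<and> dist (\<xi> b) (x j) < \<delta>"

definition pseudo_connected :: "real \<Rightarrow> nat \<Rightarrow> nat \<Rightarrow> bool" where
  "pseudo_connected \<delta> i j \<longleftrightarrow>
     (\<exists>\<xi> a c b. range \<xi> \<subseteq> K \<and> pseudo_orbit f \<delta> \<xi> \<and> excursion \<delta> i j \<xi> a c b)"

text \<open>
  Chain reachability of \<open>x j\<close> from \<open>x i\<close>, by chains that leave the ball around \<open>x i\<close>.
\<close>

definition limit_connected :: "nat \<Rightarrow> nat \<Rightarrow> bool" where
  "limit_connected i j \<longleftrightarrow> (\<forall>\<delta>>0. pseudo_connected \<delta> i j)"

lemma pseudo_connected_mono:
  assumes "pseudo_connected \<delta> i j" "\<delta> \<le> \<delta>'"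
  shows "pseudo_connected \<delta>' i j"
proof -
  obtain \<xi> a c b where \<xi>: "range \<xi> \<subseteq> K" "pseudo_orbit f \<delta> \<xi>" "excursion \<delta> i j \<xi> a c b"
    using assms(1) unfolding pseudo_connected_def by blast
  have "pseudo_orbit f \<delta>' \<xi>" "excursion \<delta>' i j \<xi> a c b"
    using \<xi>(2,3) assms(2) by (auto simp: excursion_def intro: pseudo_orbit_mono)
  then show ?thesis
    using \<xi>(1) unfolding pseudo_connected_def by blast
qed

text \<open>
  Take pseudo-orbits with errors tending to 0, shift the first exit from the ball around \<open>x i\<close> to time
  0 and pass to a limit \<open>\<zeta>\<close>. The time spent in the ball before the exit tends to infinity, because
  \<open>x i\<close> is an equilibrium; so \<open>\<zeta>\<close> is in the closed ball for all negative times and comes from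
  \<open>x i\<close>. It goes to some \<open>x l\<close>. If \<open>l \<noteq> j\<close>, the pseudo-orbits follow \<open>\<zeta>\<close> until they are near
  \<open>x l\<close>, and only later come near \<open>x j\<close>, which is outside the ball around \<open>x l\<close>: these are again
  excursions, now from \<open>l\<close> to \<open>j\<close>.
\<close>

lemma limit_connected_step:
  assumes ij: "i \<in> {1..p}" "j \<in> {1..p}" and pc: "limit_connected i j"
  shows "\<exists>l. (i, l) \<in> connection \<and> (l = j \<or> limit_connected l j)"
proof -
  define \<delta> where "\<delta> k = inverse (real (Suc k))" for k
  have \<delta>: "\<delta> k > 0" "\<delta> \<longlonglongrightarrow> 0" for k
    using LIMSEQ_inverse_real_of_nat by (auto simp: \<delta>_def[abs_def])
  have "\<exists>\<xi> a c b. range \<xi> \<subseteq> K \<and> pseudo_orbit f (\<delta> k) \<xi> \<and> excursion (\<delta> k) i j \<xi> a c b" for k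
    using pc \<delta>(1) unfolding limit_connected_def pseudo_connected_def by blast
  then obtain \<xi> a c b where \<xi>: "\<And>k. range (\<xi> k) \<subseteq> K" "\<And>k. pseudo_orbit f (\<delta> k) (\<xi> k)"
      "\<And>k. excursion (\<delta> k) i j (\<xi> k) (a k) (c k) (b k)"
    by metis
  \<comment> \<open>replace the time outside the ball by the first such time after \<open>a k\<close>\<close>
  have "\<exists>e. excursion (\<delta> k) i j (\<xi> k) (a k) e (b k) \<and> (\<forall>m. a k \<le> m \<and> m < e \<longrightarrow> dist (\<xi> k m) (x i) < r)" for k
  proof -
    define P where "P n \<longleftrightarrow> r \<le> dist (\<xi> k (a k + int n)) (x i)" for n
    have "P (nat (c k - a k))"
      using \<xi>(3)[of k] by (simp add: excursion_def P_def)
    then have P: "P (LEAST n. P n)" "(LEAST n. P n) \<le> nat (c k - a k)"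
      by (auto intro: LeastI Least_le)
    let ?e = "a k + int (LEAST n. P n)"
    have "dist (\<xi> k m) (x i) < r" if "a k \<le> m" "m < ?e" for m
    proof -
      have "\<not> P (nat (m - a k))"
        using that by (intro not_less_Least) auto
      then show ?thesis
        using that by (simp add: P_def)
    qed
    moreover have "excursion (\<delta> k) i j (\<xi> k) (a k) ?e (b k)"
      using \<xi>(3)[of k] P by (auto simp: excursion_def P_def)
    ultimately show ?thesis
      by blast
  qed
  then obtain e where e: "\<And>k. excursion (\<delta> k) i j (\<xi> k) (a k) (e k) (b k)"
    "\<And>k m. a k \<le> m \<Longrightarrow> m < e k \<Longrightarrow> dist (\<xi> k m) (x i) < r"
    by metis
  define \<eta> where "\<eta> k m = \<xi> k (m + e k)" for k m
  have \<eta>: "range (\<eta> k) \<subseteq> K" "pseudo_orbit f (\<delta> k) (\<eta> k)" for k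
    using \<xi>(1)[of k] pseudo_orbit_shift[OF \<xi>(2)[of k]] by (auto simp: \<eta>_def[abs_def])
  obtain s \<zeta> where s: "strict_mono (s :: nat \<Rightarrow> nat)" and \<zeta>: "global_solution f \<zeta>" "range \<zeta> \<subseteq> K"
    and lim: "\<And>m. (\<lambda>k. \<eta> (s k) m) \<longlonglongrightarrow> \<zeta> m"
    using pseudo_orbits_subsequence[OF compact_K cont_f \<eta> \<delta>(2)] by blast
  have \<delta>s: "(\<lambda>k. \<delta> (s k)) \<longlonglongrightarrow> 0"
    using LIMSEQ_subseq_LIMSEQ[OF \<delta>(2) s] by (simp add: o_def)
  have to_lim: "(\<lambda>k. \<eta> (s k) (g k)) \<longlonglongrightarrow> y" if "\<And>k. dist (\<eta> (s k) (g k)) y < \<delta> (s k)" for g y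
  proof -
    have "eventually (\<lambda>k. norm (dist (\<eta> (s k) (g k)) y) \<le> \<delta> (s k)) sequentially"
      using that by (simp add: less_imp_le)
    then have "(\<lambda>k. dist (\<eta> (s k) (g k)) y) \<longlonglongrightarrow> 0"
      using \<delta>s by (rule Lim_null_comparison)
    then show ?thesis
      using tendsto_dist_iff by blast
  qed
  have at_a: "(\<lambda>k. \<eta> (s k) (a (s k) - e (s k))) \<longlonglongrightarrow> x i"
    by (rule to_lim) (use e(1) in \<open>auto simp: \<eta>_def excursion_def\<close>)
  have at_b: "(\<lambda>k. \<eta> (s k) (b (s k) - e (s k))) \<longlonglongrightarrow> x j"
    by (rule to_lim) (use e(1) in \<open>auto simp: \<eta>_def excursion_def\<close>)
  have out: "r \<le> dist (\<zeta> 0) (x i)"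
    by (rule tendsto_lowerbound[OF tendsto_dist[OF lim tendsto_const]])
      (use e(1) in \<open>auto simp: \<eta>_def excursion_def\<close>)
  have early: "eventually (\<lambda>k. a (s k) - e (s k) < - int N) sequentially" for N
  proof (rule ccontr)
    assume "\<not> ?thesis"
    then have "frequently (\<lambda>k. a (s k) - e (s k) \<in> {- int N..0}) sequentially"
      unfolding frequently_def
      by (rule contrapos_nn, elim eventually_mono) (use e(1) in \<open>auto simp: excursion_def\<close>)
    from limit_hits[OF lim _ this at_a] obtain m where "m \<le> 0" "\<zeta> m = x i"
      by auto
    then have "\<zeta> 0 = x i"
      using solution_stays[OF \<zeta>(1) _ ij(1)] by blast
    then show False
      using out r_pos by simp
  qed
  have near: "dist (\<zeta> m) (x i) \<le> r" if "m < 0" for m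
  proof (rule tendsto_upperbound[OF tendsto_dist[OF lim tendsto_const]])
    show "eventually (\<lambda>k. dist (\<eta> (s k) m) (x i) \<le> r) sequentially"
      using early[of "nat (- m)"]
    proof eventually_elim
      case (elim k)
      then show ?case
        using e(2)[of "s k" "m + e (s k)"] that by (simp add: \<eta>_def less_imp_le)
    qed
  qed simp
  obtain i' l where l: "i' \<in> {1..p}" "l \<in> {1..p}"
    and lim_bot: "((\<lambda>m. dist (\<zeta> m) (x i')) \<longlongrightarrow> 0) at_bot"
    and lim_top: "((\<lambda>m. dist (\<zeta> m) (x l)) \<longlongrightarrow> 0) at_top"
    using dichotomy[OF \<zeta>] by blast
  have "i' = i"
  proof (rule ccontr)
    assume "i' \<noteq> i"
    have "eventually (\<lambda>m. dist (\<zeta> m) (x i') < r) at_bot"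
      using r_pos by (intro order_tendstoD(2)[OF lim_bot])
    then obtain m1 where "\<And>m. m \<le> m1 \<Longrightarrow> dist (\<zeta> m) (x i') < r"
      by (auto simp: eventually_at_bot_linorder)
    then have "dist (\<zeta> (min m1 (- 1))) (x i') < r" "dist (\<zeta> (min m1 (- 1))) (x i) \<le> r"
      using near by auto
    then have "dist (x i') (x i) < 2 * r"
      using dist_triangle3[of "x i'" "x i" "\<zeta> (min m1 (- 1))"] by simp
    then show False
      using separated[OF l(1) ij(1) \<open>i' \<noteq> i\<close>] by simp
  qed
  have "(i, l) \<in> connection"
  proof -
    have "\<not> range \<zeta> \<subseteq> {x n}" for n
    proof
      assume "range \<zeta> \<subseteq> {x n}"
      then have const: "\<zeta> m = x n" for m
        by auto
      have "dist (x n) (x i) = 0"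
        using lim_bot \<open>i' = i\<close> by (simp add: const tendsto_const_iff)
      then show False
        using out r_pos by (simp add: const)
    qed
    moreover have "bounded (range \<zeta>)"
      using \<zeta>(2) compact_K by (meson bounded_subset compact_imp_bounded)
    ultimately show ?thesis
      using ij l \<zeta>(1) lim_bot lim_top \<open>i' = i\<close>
      by (auto simp: connection_def backward_to_def forward_to_def)
  qed
  moreover have "l = j \<or> limit_connected l j"
  proof (rule disjCI)
    assume npc: "\<not> limit_connected l j"
    show "l = j"
    proof (rule ccontr)
      assume "l \<noteq> j"
      have late: "eventually (\<lambda>k. int N < b (s k) - e (s k)) sequentially" for N
      proof (rule ccontr)
        assume "\<not> ?thesis"
        then have "frequently (\<lambda>k. b (s k) - e (s k) \<in> {0..int N}) sequentially"
          unfolding frequently_def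
          by (rule contrapos_nn, elim eventually_mono) (use e(1) in \<open>auto simp: excursion_def\<close>)
        from limit_hits[OF lim _ this at_b] obtain m where m: "\<zeta> m = x j"
          by auto
        have "eventually (\<lambda>n. dist (\<zeta> n) (x l) = dist (x j) (x l)) at_top"
          using eventually_ge_at_top[of m]
          by eventually_elim (simp add: solution_stays[OF \<zeta>(1) m ij(2)])
        then have "((\<lambda>n::int. dist (x j) (x l)) \<longlongrightarrow> 0) at_top"
          using lim_top by (rule Lim_transform_eventually[rotated])
        then show False
          using separated[OF l(2) ij(2) \<open>l \<noteq> j\<close>] r_pos by (simp add: tendsto_const_iff dist_commute)
      qed
      have "limit_connected l j"
        unfolding limit_connected_def pseudo_connected_def
      proof (intro allI impI)
        fix d :: real assume "d > 0"
        \<comment> \<open>below \<open>r\<close>, closeness to \<open>x j\<close> implies being outside the ball around \<open>x l\<close>\<close>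
        define d' where "d' = min d r"
        have d': "d' > 0" "d' \<le> d" "d' \<le> r"
          using \<open>d > 0\<close> r_pos by (auto simp: d'_def)
        have "eventually (\<lambda>m. dist (\<zeta> m) (x l) < d') at_top"
          using d'(1) by (intro order_tendstoD(2)[OF lim_top])
        then obtain m1 where "\<And>m. m \<ge> m1 \<Longrightarrow> dist (\<zeta> m) (x l) < d'"
          by (auto simp: eventually_at_top_linorder)
        then have m: "dist (\<zeta> (int (nat m1))) (x l) < d'"
          by simp
        let ?m = "int (nat m1)"
        have "eventually (\<lambda>k. dist (\<eta> (s k) ?m) (x l) < d') sequentially"
          by (rule order_tendstoD(2)[OF tendsto_dist[OF lim tendsto_const] m])
        moreover have "eventually (\<lambda>k. \<delta> (s k) < d') sequentially"
          by (rule order_tendstoD(2)[OF \<delta>s d'(1)])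
        ultimately have "eventually (\<lambda>k. dist (\<eta> (s k) ?m) (x l) < d' \<and> \<delta> (s k) < d' \<and>
            ?m < b (s k) - e (s k)) sequentially"
          using late[of "nat m1"] by eventually_elim simp
        then obtain k where k: "dist (\<eta> (s k) ?m) (x l) < d'" "\<delta> (s k) < d'" "?m < b (s k) - e (s k)"
          using eventually_happens'[OF sequentially_bot] by blast
        let ?b = "b (s k) - e (s k)"
        have near_j: "dist (\<eta> (s k) ?b) (x j) < d'"
          using e(1)[of "s k"] k(2) by (simp add: \<eta>_def excursion_def)
        have "r \<le> dist (\<eta> (s k) ?b) (x l)"
          using separated[OF l(2) ij(2) \<open>l \<noteq> j\<close>] near_j d'(3)
            dist_triangle3[of "x l" "x j" "\<eta> (s k) ?b"] by simp
        then have "excursion d l j (\<eta> (s k)) ?m ?b ?b"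
          using k near_j d' by (simp add: excursion_def)
        moreover have "pseudo_orbit f d (\<eta> (s k))"
          using \<eta>(2) k(2) d'(2) by (meson less_imp_le order_trans pseudo_orbit_mono)
        ultimately show "\<exists>\<xi> a c b. range \<xi> \<subseteq> K \<and> pseudo_orbit f d \<xi> \<and> excursion d l j \<xi> a c b"
          using \<eta>(1) by blast
      qed
      then show False
        using npc by simp
    qed
  qed
  ultimately show ?thesis
    by blast
qed

text \<open>
  Each step moves forward in an acyclic finite relation, so the iteration ends.
\<close>

lemma limit_connected_imp_connection:
  assumes "i \<in> {1..p}" "j \<in> {1..p}" "limit_connected i j"
  shows "(i, j) \<in> connection\<^sup>+"
proof -
  have "wf (connection\<inverse>)"
    using finite_connection acyclic_connection by (rule finite_acyclic_wf_converse)
  then show ?thesis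
    using assms
  proof (induction i rule: wf_induct_rule)
    case (less i)
    obtain l where l: "(i, l) \<in> connection" "l = j \<or> limit_connected l j"
      using limit_connected_step[OF less.prems] by blast
    moreover have "l \<in> {1..p}"
      using l(1) by (auto simp: connection_def)
    ultimately show ?case
      using less.IH[of l] less.prems(2) by (auto intro: trancl_into_trancl2)
  qed
qed

lemma excursions_follow_connections:
  "\<exists>\<delta>>0. \<forall>i\<in>{1..p}. \<forall>j\<in>{1..p}. pseudo_connected \<delta> i j \<longrightarrow> (i, j) \<in> connection\<^sup>+"
proof -
  have "eventually (\<lambda>\<delta>. pseudo_connected \<delta> i j \<longrightarrow> (i, j) \<in> connection\<^sup>+) (at_right 0)"
    if ij: "i \<in> {1..p}" "j \<in> {1..p}" for i j
  proof (cases "limit_connected i j")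
    case True
    then show ?thesis
      using limit_connected_imp_connection[OF ij] by simp
  next
    case False
    then obtain d where "d > 0" "\<not> pseudo_connected d i j"
      unfolding limit_connected_def by blast
    then show ?thesis
      unfolding eventually_at_right_field using pseudo_connected_mono less_imp_le by blast
  qed
  then have "eventually (\<lambda>\<delta>. \<forall>i\<in>{1..p}. \<forall>j\<in>{1..p}. pseudo_connected \<delta> i j \<longrightarrow> (i, j) \<in> connection\<^sup>+) (at_right 0)"
    by (simp add: eventually_ball_finite)
  then show ?thesis
    using eventually_at_right_less[of "0::real"] eventually_happens'[OF trivial_limit_at_right_real]
      eventually_conj by blast
qed

text \<open>
  Otherwise a limit of longer and longer pseudo-orbit segments would be a solution that stays away from
  all equilibria for positive times, although it converges to one of them.
\<close>

lemma uniform_hitting_time: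
  assumes "\<epsilon> > 0"
  shows "\<exists>\<delta>>0. \<exists>N. \<forall>\<xi> m. range \<xi> \<subseteq> K \<and> pseudo_orbit f \<delta> \<xi> \<longrightarrow>
     (\<exists>t\<in>{m..m + int N}. \<exists>j\<in>{1..p}. dist (\<xi> t) (x j) < \<epsilon>)"
proof (rule ccontr)
  assume "\<not> ?thesis"
  then have neg: "\<exists>\<xi> m. range \<xi> \<subseteq> K \<and> pseudo_orbit f d \<xi> \<and>
      \<not> (\<exists>t\<in>{m..m + int N}. \<exists>j\<in>{1..p}. dist (\<xi> t) (x j) < \<epsilon>)" if "d > 0" for d N
    using that by blast
  define \<delta> where "\<delta> k = inverse (real (Suc k))" for k
  have \<delta>: "\<delta> k > 0" "\<delta> \<longlonglongrightarrow> 0" for k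
    using LIMSEQ_inverse_real_of_nat by (auto simp: \<delta>_def[abs_def])
  have "\<exists>\<xi> m. range \<xi> \<subseteq> K \<and> pseudo_orbit f (\<delta> k) \<xi> \<and>
      (\<forall>t\<in>{m..m + int k}. \<forall>j\<in>{1..p}. \<epsilon> \<le> dist (\<xi> t) (x j))" for k
    using neg[OF \<delta>(1), of k k] by (simp add: not_less)
  then obtain \<xi> m where \<xi>: "\<And>k. range (\<xi> k) \<subseteq> K" "\<And>k. pseudo_orbit f (\<delta> k) (\<xi> k)"
    and far: "\<And>k t j. t \<in> {m k..m k + int k} \<Longrightarrow> j \<in> {1..p} \<Longrightarrow> \<epsilon> \<le> dist (\<xi> k t) (x j)"
    by metis
  define \<eta> where "\<eta> k n = \<xi> k (n + m k)" for k n
  have \<eta>: "range (\<eta> k) \<subseteq> K" "pseudo_orbit f (\<delta> k) (\<eta> k)" for k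
    using \<xi>(1)[of k] pseudo_orbit_shift[OF \<xi>(2)[of k]] by (auto simp: \<eta>_def[abs_def])
  obtain s \<zeta> where s: "strict_mono (s :: nat \<Rightarrow> nat)" and \<zeta>: "global_solution f \<zeta>" "range \<zeta> \<subseteq> K"
    and lim: "\<And>m. (\<lambda>k. \<eta> (s k) m) \<longlonglongrightarrow> \<zeta> m"
    using pseudo_orbits_subsequence[OF compact_K cont_f \<eta> \<delta>(2)] by blast
  obtain j where j: "j \<in> {1..p}" "((\<lambda>m. dist (\<zeta> m) (x j)) \<longlongrightarrow> 0) at_top"
    using dichotomy[OF \<zeta>] by blast
  have "\<epsilon> \<le> dist (\<zeta> t) (x j)" if "t \<ge> 0" for t
  proof (rule tendsto_lowerbound[OF tendsto_dist[OF lim tendsto_const]])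
    show "eventually (\<lambda>k. \<epsilon> \<le> dist (\<eta> (s k) t) (x j)) sequentially"
      using eventually_ge_at_top[of "nat t"]
    proof eventually_elim
      case (elim k)
      then have "nat t \<le> s k"
        using seq_suble[OF s, of k] by linarith
      then show ?case
        using far[of "t + m (s k)" "s k" j] j(1) that by (simp add: \<eta>_def)
    qed
  qed simp
  moreover obtain m1 where "\<And>m. m \<ge> m1 \<Longrightarrow> dist (\<zeta> m) (x j) < \<epsilon>"
    using order_tendstoD(2)[OF j(2) assms] by (auto simp: eventually_at_top_linorder)
  ultimately show False
    by (metis linorder_not_less max.cobounded1 max.cobounded2)
qed

section \<open>Persistence of the gradient structure\<close>

definition settling :: "real \<Rightarrow> bool" where
  "settling \<delta> \<longleftrightarrow> (\<forall>\<xi>. range \<xi> \<subseteq> K \<and> pseudo_orbit f \<delta> \<xi> \<longrightarrow>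
     (\<exists>i\<in>{1..p}. eventually (\<lambda>m. dist (\<xi> m) (x i) < r) at_bot) \<and>
     (\<exists>j\<in>{1..p}. eventually (\<lambda>m. dist (\<xi> m) (x j) < r) at_top) \<and>
     (\<forall>i\<in>{1..p}. \<forall>j\<in>{1..p}. \<forall>a c b. excursion \<delta> i j \<xi> a c b \<longrightarrow> (i, j) \<in> connection\<^sup>+))"

lemma settlingD:
  assumes "settling \<delta>" "range \<xi> \<subseteq> K" "pseudo_orbit f \<delta> \<xi>"
  shows "\<exists>i\<in>{1..p}. eventually (\<lambda>m. dist (\<xi> m) (x i) < r) at_bot"
    "\<exists>j\<in>{1..p}. eventually (\<lambda>m. dist (\<xi> m) (x j) < r) at_top"
    "i \<in> {1..p} \<Longrightarrow> j \<in> {1..p} \<Longrightarrow> excursion \<delta> i j \<xi> a c b \<Longrightarrow> (i, j) \<in> connection\<^sup>+"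
  using assms unfolding settling_def by blast+

text \<open>
  Some equilibrium is approached at arbitrarily large times, by finiteness of the family. Leaving its
  ball between two approaches would be an excursion from an index to itself, which acyclicity
  forbids. The same argument applies to negative times.
\<close>

lemma pseudo_orbits_settle:
  "\<exists>\<delta>>0. \<delta> \<le> r \<and> settling \<delta>"
proof -
  obtain \<epsilon> where \<epsilon>: "\<epsilon> > 0"
    "\<And>i j. i \<in> {1..p} \<Longrightarrow> j \<in> {1..p} \<Longrightarrow> pseudo_connected \<epsilon> i j \<Longrightarrow> (i, j) \<in> connection\<^sup>+"
    using excursions_follow_connections by blast
  obtain d N where d: "d > 0" and hit: "\<And>\<xi> m. range \<xi> \<subseteq> K \<Longrightarrow> pseudo_orbit f d \<xi> \<Longrightarrow>
     \<exists>t\<in>{m..m + int N}. \<exists>j\<in>{1..p}. dist (\<xi> t) (x j) < \<epsilon>"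
    using uniform_hitting_time[OF \<epsilon>(1)] by blast
  let ?\<delta> = "min r (min \<epsilon> d)"
  have "(\<exists>i\<in>{1..p}. eventually (\<lambda>m. dist (\<xi> m) (x i) < r) at_bot) \<and>
     (\<exists>j\<in>{1..p}. eventually (\<lambda>m. dist (\<xi> m) (x j) < r) at_top) \<and>
     (\<forall>i\<in>{1..p}. \<forall>j\<in>{1..p}. \<forall>a c b. excursion ?\<delta> i j \<xi> a c b \<longrightarrow> (i, j) \<in> connection\<^sup>+)"
    if K: "range \<xi> \<subseteq> K" and po: "pseudo_orbit f ?\<delta> \<xi>" for \<xi>
  proof (intro conjI)
    have po1: "pseudo_orbit f \<epsilon> \<xi>" and po2: "pseudo_orbit f d \<xi>"
      using po by (auto elim: pseudo_orbit_mono)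
    have follow: "(i, j) \<in> connection\<^sup>+" if "i \<in> {1..p}" "j \<in> {1..p}" "excursion \<epsilon> i j \<xi> a c b" for i j a c b
      using \<epsilon>(2)[OF that(1,2)] that(3) K po1 unfolding pseudo_connected_def by blast
    have no_return: False if "i \<in> {1..p}" "excursion \<epsilon> i i \<xi> a c b" for i a c b
      using follow[OF that(1,1,2)] acyclic_connection by (simp add: acyclic_def)
    show "\<forall>i\<in>{1..p}. \<forall>j\<in>{1..p}. \<forall>a c b. excursion ?\<delta> i j \<xi> a c b \<longrightarrow> (i, j) \<in> connection\<^sup>+"
      by (intro ballI allI impI follow) (auto simp: excursion_def)
    show "\<exists>j\<in>{1..p}. eventually (\<lambda>m. dist (\<xi> m) (x j) < r) at_top"
    proof -
      have "frequently (\<lambda>m. \<exists>j\<in>{1..p}. dist (\<xi> m) (x j) < \<epsilon>) at_top"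
        unfolding frequently_def eventually_at_top_linorder
        using hit[OF K po2] by (meson atLeastAtMost_iff)
      then obtain j where j: "j \<in> {1..p}" "frequently (\<lambda>m. dist (\<xi> m) (x j) < \<epsilon>) at_top"
        unfolding frequently_bex_finite_distrib[OF finite_atLeastAtMost] by blast
      then have later: "\<exists>t\<ge>m. dist (\<xi> t) (x j) < \<epsilon>" for m
        unfolding frequently_def eventually_at_top_linorder by blast
      obtain a where a: "dist (\<xi> a) (x j) < \<epsilon>"
        using later by blast
      have "dist (\<xi> c) (x j) < r" if "c \<ge> a" for c
        using later[of c] no_return[OF j(1), of a c] a that by (force simp: excursion_def not_less)
      then show ?thesis
        using j(1) unfolding eventually_at_top_linorder by blast
    qed
    show "\<exists>i\<in>{1..p}. eventually (\<lambda>m. dist (\<xi> m) (x i) < r) at_bot"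
    proof -
      have "\<exists>t\<le>m. \<exists>j\<in>{1..p}. dist (\<xi> t) (x j) < \<epsilon>" for m
        using hit[OF K po2, of "m - int N"] by force
      then have "frequently (\<lambda>m. \<exists>j\<in>{1..p}. dist (\<xi> m) (x j) < \<epsilon>) at_bot"
        unfolding frequently_def eventually_at_bot_linorder by blast
      then obtain j where j: "j \<in> {1..p}" "frequently (\<lambda>m. dist (\<xi> m) (x j) < \<epsilon>) at_bot"
        unfolding frequently_bex_finite_distrib[OF finite_atLeastAtMost] by blast
      then have earlier: "\<exists>t\<le>m. dist (\<xi> t) (x j) < \<epsilon>" for m
        unfolding frequently_def eventually_at_bot_linorder by blast
      obtain b where b: "dist (\<xi> b) (x j) < \<epsilon>"
        using earlier by blast
      have "dist (\<xi> c) (x j) < r" if "c \<le> b" for c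
        using earlier[of c] no_return[OF j(1), of _ c b] b that by (force simp: excursion_def not_less)
      then show ?thesis
        using j(1) unfolding eventually_at_bot_linorder by blast
    qed
  qed
  moreover have "?\<delta> > 0" "?\<delta> \<le> r"
    using r_pos \<epsilon>(1) d by auto
  ultimately show ?thesis
    unfolding settling_def by blast
qed

end

section \<open>Attractors and unstable sets\<close>

lemma funpow_solution: "global_solution T \<xi> \<Longrightarrow> (T ^^ n) (\<xi> m) = \<xi> (m + int n)"
  by (induction n) (auto simp: global_solution_def algebra_simps)

text \<open>
  The point \<open>\<xi> m\<close> is the image under \<open>T ^^ n\<close> of a point of the bounded set \<open>\<xi> ` {..m}\<close>,
  for every \<open>n\<close>, and the attractor attracts this set uniformly.
\<close>

lemma solution_in_attractor:
  assumes A: "global_attractor T A" and sol: "global_solution T \<xi>" and bd: "bounded (\<xi> ` {..m})"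
  shows "\<xi> m \<in> A"
proof -
  have "infdist (\<xi> m) A \<le> e" if "e > 0" for e
  proof -
    have "uniform_limit (\<xi> ` {..m}) (\<lambda>n x. infdist ((T ^^ n) x) A) (\<lambda>x. 0) sequentially"
      using A bd by (simp add: global_attractor_def)
    then obtain n where "\<And>y. y \<in> \<xi> ` {..m} \<Longrightarrow> dist (infdist ((T ^^ n) y) A) 0 < e"
      using uniform_limitD[OF _ \<open>e > 0\<close>] eventually_happens'[OF sequentially_bot] by blast
    then have "dist (infdist ((T ^^ n) (\<xi> (m - int n))) A) 0 < e"
      by auto
    then show ?thesis
      by (simp add: funpow_solution[OF sol])
  qed
  then have "infdist (\<xi> m) A = 0"
    using infdist_nonneg[of "\<xi> m" A] field_le_epsilon[of "infdist (\<xi> m) A" 0] by force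
  then show ?thesis
    using A in_closed_iff_infdist_zero[of A] by (simp add: global_attractor_def compact_imp_closed)
qed

lemma solution_through_point:
  assumes T: "T ` A = A" and x: "x \<in> A"
  obtains \<xi> where "global_solution T \<xi>" "\<xi> 0 = x" "range \<xi> \<subseteq> A"
proof -
  have "\<forall>y\<in>A. \<exists>z. z \<in> A \<and> T z = y"
    using T by (metis imageE)
  then obtain g where g: "\<And>y. y \<in> A \<Longrightarrow> g y \<in> A" "\<And>y. y \<in> A \<Longrightarrow> T (g y) = y"
    using bchoice[of A "\<lambda>y z. z \<in> A \<and> T z = y"] by blast
  \<comment> \<open>forward images of \<open>x\<close>, and preimages chosen inside \<open>A\<close>\<close>
  define \<xi> where "\<xi> m = (if m \<ge> 0 then (T ^^ nat m) x else (g ^^ nat (- m)) x)" for m :: int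
  have gA: "(g ^^ n) x \<in> A" and TA: "(T ^^ n) x \<in> A" for n
    using x g(1) T by (induction n) auto
  have "T (\<xi> m) = \<xi> (m + 1)" for m
  proof (cases "m \<ge> 0")
    case True
    then show ?thesis
      by (simp add: \<xi>_def nat_add_distrib)
  next
    case False
    define n where "n = nat (- m - 1)"
    have n: "m = - 1 - int n"
      using False by (simp add: n_def)
    have "T ((g ^^ Suc n) x) = (g ^^ n) x"
      using g(2)[OF gA] by simp
    moreover have "nat (- m) = Suc n"
      using n by simp
    moreover have "\<xi> (m + 1) = (g ^^ n) x"
      using n by (simp add: \<xi>_def)
    ultimately show ?thesis
      using False by (simp add: \<xi>_def)
  qed
  moreover have "range \<xi> \<subseteq> A"
    using gA TA by (auto simp: \<xi>_def)
  ultimately show ?thesis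
    using that[of \<xi>] by (simp add: global_solution_def \<xi>_def)
qed

lemma attractor_eq_unstable_sets:
  fixes T :: "'a::real_normed_vector \<Rightarrow> 'a"
  assumes A: "global_attractor T A" and grad: "dynamically_gradient T p (\<lambda>i. {x i})"
  shows "A = (\<Union>i\<in>{1..p}. unstable_set T (x i))"
proof (intro equalityI subsetI)
  fix y assume "y \<in> A"
  then obtain \<xi> where \<xi>: "global_solution T \<xi>" "\<xi> 0 = y" "range \<xi> \<subseteq> A"
    using A solution_through_point unfolding global_attractor_def by metis
  have "bounded (range \<xi>)"
    using A \<xi>(3) unfolding global_attractor_def by (meson bounded_subset compact_imp_bounded)
  then obtain i where "i \<in> {1..p}" "backward_to \<xi> {x i}"
    using grad \<xi>(1) unfolding dynamically_gradient_def by blast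
  then show "y \<in> (\<Union>i\<in>{1..p}. unstable_set T (x i))"
    using \<xi> by (auto simp: unstable_set_def backward_to_def dist_norm)
next
  fix y assume "y \<in> (\<Union>i\<in>{1..p}. unstable_set T (x i))"
  then obtain i \<xi> where \<xi>: "global_solution T \<xi>" "\<xi> 0 = y" and lim: "((\<lambda>m. norm (\<xi> m - x i)) \<longlongrightarrow> 0) at_bot"
    by (auto simp: unstable_set_def)
  have "eventually (\<lambda>m. norm (\<xi> m - x i) < 1) at_bot"
    by (rule order_tendstoD(2)[OF lim]) simp
  then obtain m0 where m0: "\<And>m. m \<le> m0 \<Longrightarrow> norm (\<xi> m - x i) < 1"
    by (auto simp: eventually_at_bot_linorder)
  have "\<xi> ` {..0} \<subseteq> ball (x i) 1 \<union> \<xi> ` {m0..0}"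
  proof
    fix z assume "z \<in> \<xi> ` {..0}"
    then obtain m where m: "m \<le> 0" "z = \<xi> m"
      by auto
    then show "z \<in> ball (x i) 1 \<union> \<xi> ` {m0..0}"
      using m0[of m] by (cases "m \<le> m0") (auto simp: dist_norm norm_minus_commute)
  qed
  then have "bounded (\<xi> ` {..0})"
    by (rule bounded_subset[rotated]) (simp add: finite_imp_bounded)
  then show "y \<in> A"
    using solution_in_attractor[OF A \<xi>(1)] \<xi>(2) by blast
qed

section \<open>Perturbed families\<close>

lemma triple_norm_on_lipschitz:
  assumes "triple_norm_on U F < ennreal \<epsilon>" "x \<in> U" "y \<in> U"
  shows "norm (F x - F y) \<le> \<epsilon> * norm (x - y)"
proof (cases "x = y")
  case False
  have "ennreal (norm (F x - F y) / norm (x - y)) \<le> triple_norm_on U F"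
    unfolding triple_norm_on_def using assms(2,3) False
    by (intro max.coboundedI2 SUP_upper2[of "(x, y)"]) auto
  then have "ennreal (norm (F x - F y) / norm (x - y)) < ennreal \<epsilon>"
    using assms(1) by (rule le_less_trans)
  then have "norm (F x - F y) / norm (x - y) < \<epsilon>"
    by (simp add: ennreal_less_iff)
  then show ?thesis
    using False by (simp add: pos_divide_less_eq)
qed simp

lemma isolated_points:
  assumes "isolated_invariant_family T A p (\<lambda>i. {x i})"
  shows "i \<in> {1..p} \<Longrightarrow> x i \<in> A" "inj_on x {1..p}"
proof -
  show "i \<in> {1..p} \<Longrightarrow> x i \<in> A"
    using assms by (simp add: isolated_invariant_family_def isolated_invariant_def)
  obtain r where r: "r > 0" "\<forall>i\<in>{1..p}. \<forall>j\<in>{1..p}. i \<noteq> j \<longrightarrow> nbhd_radius r {x i} \<inter> nbhd_radius r {x j} = {}"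
    using assms unfolding isolated_invariant_family_def by blast
  have mem: "x i \<in> nbhd_radius r {x i}" for i
    using r(1) by (simp add: nbhd_radius_def)
  show "inj_on x {1..p}"
  proof (rule inj_onI, rule ccontr)
    fix i j assume "i \<in> {1..p}" "j \<in> {1..p}" and eq: "x i = x j" and "i \<noteq> j"
    then have "nbhd_radius r {x i} \<inter> nbhd_radius r {x j} = {}"
      using r(2) by blast
    then show False
      using mem[of i] by (simp add: eq)
  qed
qed

text \<open>
  The radius is chosen before \<open>\<eta>\<close>: the bound on \<open>\<eta>\<close> that the compactness argument gives depends on
  the balls.
\<close>

lemma perturbations_synchronizing:
  fixes T :: "real \<Rightarrow> 'a::banach \<Rightarrow> 'a"
  assumes hyp: "weakly_hyperbolic_decomposition (T 0) x0 L N a b nrm \<gamma>" and x0: "x0 \<in> interior U"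
    and lim: "((\<lambda>\<eta>. triple_norm_on U (\<lambda>x. T \<eta> x - T 0 x)) \<longlongrightarrow> 0) (at_right 0)"
  shows "eventually (\<lambda>r. eventually (\<lambda>\<eta>. synchronizing_on (ball x0 r) (T \<eta>)) (at_right 0)) (at_right 0)"
proof -
  obtain R \<epsilon> where R: "R > 0" "\<epsilon> > 0" and sync: "\<forall>B S. B \<subseteq> ball x0 R \<and>
      (\<forall>u\<in>B. \<forall>v\<in>B. norm ((S u - T 0 u) - (S v - T 0 v)) \<le> \<epsilon> * norm (u - v)) \<longrightarrow> synchronizing_on B S"
    using weakly_hyperbolic_imp_synchronizing[OF hyp] by (elim exE conjE)
  obtain \<rho> where \<rho>: "\<rho> > 0" "ball x0 \<rho> \<subseteq> U"
    using x0 by (auto simp: mem_interior)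
  have small: "eventually (\<lambda>\<eta>. triple_norm_on U (\<lambda>x. T \<eta> x - T 0 x) < ennreal \<epsilon>) (at_right 0)"
    using R(2) by (intro order_tendstoD(2)[OF lim]) simp
  have ev: "eventually (\<lambda>\<eta>. synchronizing_on (ball x0 r) (T \<eta>)) (at_right 0)" if r: "r < min R \<rho>" for r
    using small
  proof eventually_elim
    case (elim \<eta>)
    have sub: "ball x0 r \<subseteq> U" "ball x0 r \<subseteq> ball x0 R"
      using \<rho>(2) r by auto
    have "norm ((T \<eta> u - T 0 u) - (T \<eta> v - T 0 v)) \<le> \<epsilon> * norm (u - v)"
      if "u \<in> ball x0 r" "v \<in> ball x0 r" for u v
      using triple_norm_on_lipschitz[OF elim, of u v] sub(1) that by blast
    then show ?case
      using sync sub(2) by blast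
  qed
  have "\<exists>b>0. \<forall>r>0. r < b \<longrightarrow> eventually (\<lambda>\<eta>. synchronizing_on (ball x0 r) (T \<eta>)) (at_right 0)"
    using ev R(1) \<rho>(1) by (intro exI[of _ "min R \<rho>"]) simp
  then show ?thesis
    by (rule iffD2[OF eventually_at_right_field])
qed

context gradient_on_compact
begin

text \<open>
  The map \<open>\<sigma>\<close> that sends an equilibrium of \<open>S\<close> to the index of the ball containing it is injective by
  uniqueness in the balls, hence onto: every ball in which a solution of \<open>S\<close> can settle contains an
  equilibrium of \<open>S\<close>, to which the solution then converges. A connecting solution of \<open>S\<close> is not
  contained in the ball where it starts, again by uniqueness, so it makes an excursion.
\<close>

lemma perturbation_dynamically_gradient:
  assumes \<delta>: "\<delta> \<le> r" "settling \<delta>"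
    and sync: "\<And>i. i \<in> {1..p} \<Longrightarrow> synchronizing_on (ball (x i) r) S"
    and orb: "\<And>\<xi>. global_solution S \<xi> \<Longrightarrow> bounded (range \<xi>) \<Longrightarrow> range \<xi> \<subseteq> K \<and> pseudo_orbit f \<delta> \<xi>"
    and eq: "\<And>i. i \<in> {1..p} \<Longrightarrow> S (y i) = y i" and inj: "inj_on y {1..p}"
    and near: "\<And>i. i \<in> {1..p} \<Longrightarrow> \<exists>j\<in>{1..p}. dist (y i) (x j) < \<delta>"
  shows "dynamically_gradient S p (\<lambda>i. {y i})"
proof -
  obtain \<sigma> where \<sigma>: "\<And>i. i \<in> {1..p} \<Longrightarrow> \<sigma> i \<in> {1..p}" "\<And>i. i \<in> {1..p} \<Longrightarrow> dist (y i) (x (\<sigma> i)) < \<delta>"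
    using near by metis
  have const: "global_solution S (\<lambda>m. y i)" if "i \<in> {1..p}" for i
    using eq[OF that] by (simp add: global_solution_def)
  have in_ball: "y i \<in> ball (x (\<sigma> i)) r" if "i \<in> {1..p}" for i
    using \<sigma>(2)[OF that] \<delta>(1) by (simp add: dist_commute)
  have equal: "\<xi> = (\<lambda>m. y i)" if "i \<in> {1..p}" "global_solution S \<xi>" "range \<xi> \<subseteq> ball (x (\<sigma> i)) r" for \<xi> i
  proof -
    have "range (\<lambda>m::int. y i) \<subseteq> ball (x (\<sigma> i)) r"
      using in_ball[OF that(1)] by auto
    then show ?thesis
      by (rule synchronizing_onD(1)[OF sync[OF \<sigma>(1)[OF that(1)]] that(2) const[OF that(1)] that(3)])
  qed
  have "inj_on \<sigma> {1..p}"
  proof (rule inj_onI)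
    fix i j assume ij: "i \<in> {1..p}" "j \<in> {1..p}" "\<sigma> i = \<sigma> j"
    have "(\<lambda>m::int. y j) = (\<lambda>m. y i)"
      using ij in_ball[OF ij(2)] by (intro equal const) auto
    then have "y i = y j"
      by metis
    then show "i = j"
      using inj ij by (auto dest: inj_onD)
  qed
  then have onto: "\<sigma> ` {1..p} = {1..p}"
    using \<sigma>(1) by (intro endo_inj_surj) auto
  have gradient1: "\<exists>i\<in>{1..p}. \<exists>j\<in>{1..p}. backward_to \<xi> {y i} \<and> forward_to \<xi> {y j}"
    if sol: "global_solution S \<xi>" and bd: "bounded (range \<xi>)" for \<xi>
  proof -
    have K: "range \<xi> \<subseteq> K" and po: "pseudo_orbit f \<delta> \<xi>"
      using orb[OF sol bd] by simp_all
    obtain i0 j0 where ij0: "i0 \<in> {1..p}" "j0 \<in> {1..p}"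
      and ev: "eventually (\<lambda>m. \<xi> m \<in> ball (x i0) r) at_bot" "eventually (\<lambda>m. \<xi> m \<in> ball (x j0) r) at_top"
      using settlingD(1,2)[OF \<delta>(2) K po] by (auto simp: dist_commute)
    obtain i j where ij: "i \<in> {1..p}" "\<sigma> i = i0" "j \<in> {1..p}" "\<sigma> j = j0"
      using onto ij0 by (metis imageE)
    have "((\<lambda>m. dist (\<xi> m) (y i)) \<longlongrightarrow> 0) at_bot"
      by (rule synchronizing_onD(3)[OF sync[OF ij0(1)] sol const[OF ij(1)] ev(1)])
        (use in_ball[OF ij(1)] ij(2) in simp)
    moreover have "((\<lambda>m. dist (\<xi> m) (y j)) \<longlongrightarrow> 0) at_top"
      by (rule synchronizing_onD(2)[OF sync[OF ij0(2)] sol const[OF ij(3)] ev(2)])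
        (use in_ball[OF ij(3)] ij(4) in simp)
    ultimately show ?thesis
      using ij by (auto simp: backward_to_def forward_to_def)
  qed
  have approach: "eventually (\<lambda>m. dist (\<xi> m) (x (\<sigma> i)) < \<delta>) F"
    if "i \<in> {1..p}" "((\<lambda>m. dist (\<xi> m) (y i)) \<longlongrightarrow> 0) F" for \<xi> :: "int \<Rightarrow> 'a" and i F
  proof -
    have "eventually (\<lambda>m. dist (\<xi> m) (y i) < \<delta> - dist (y i) (x (\<sigma> i))) F"
      using \<sigma>(2)[OF that(1)] by (intro order_tendstoD(2)[OF that(2)]) simp
    then show ?thesis
    proof eventually_elim
      case (elim m)
      then show ?case
        using dist_triangle[of "\<xi> m" "x (\<sigma> i)" "y i"] by simp
    qed
  qed
  have link: "(\<sigma> i, \<sigma> j) \<in> connection\<^sup>+"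
    if ij: "i \<in> {1..p}" "j \<in> {1..p}" and sol: "global_solution S \<xi>" and bd: "bounded (range \<xi>)"
      and ne: "\<not> range \<xi> \<subseteq> {y i}" and bwd: "backward_to \<xi> {y i}" and fwd: "forward_to \<xi> {y j}" for i j \<xi>
  proof -
    have "\<not> range \<xi> \<subseteq> ball (x (\<sigma> i)) r"
      using equal[OF ij(1) sol] ne by auto
    then obtain c where "\<xi> c \<notin> ball (x (\<sigma> i)) r"
      by blast
    then have c: "r \<le> dist (\<xi> c) (x (\<sigma> i))"
      by (simp add: dist_commute)
    obtain a0 where a0: "\<And>m. m \<le> a0 \<Longrightarrow> dist (\<xi> m) (x (\<sigma> i)) < \<delta>"
      using approach[OF ij(1), of \<xi> at_bot] bwd by (auto simp: backward_to_def eventually_at_bot_linorder)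
    obtain b0 where b0: "\<And>m. m \<ge> b0 \<Longrightarrow> dist (\<xi> m) (x (\<sigma> j)) < \<delta>"
      using approach[OF ij(2), of \<xi> at_top] fwd by (auto simp: forward_to_def eventually_at_top_linorder)
    have "excursion \<delta> (\<sigma> i) (\<sigma> j) \<xi> (min a0 c) c (max b0 c)"
      using c a0 b0 by (simp add: excursion_def)
    then show ?thesis
      using settlingD(3)[OF \<delta>(2) _ _ \<sigma>(1)[OF ij(1)] \<sigma>(1)[OF ij(2)]] orb[OF sol bd] by blast
  qed
  have gradient2: False if het: "heteroclinic_structure S p (\<lambda>i. {y i}) l k \<xi>" for l k \<xi>
  proof -
    have l: "l \<ge> 1" "k (l + 1) = k 1" and kp: "\<And>n. n \<in> {1..l} \<Longrightarrow> k n \<in> {1..p}"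
      and \<xi>: "\<And>n. n \<in> {1..l} \<Longrightarrow> global_solution S (\<xi> n) \<and> bounded (range (\<xi> n)) \<and>
        (\<forall>j\<in>{1..p}. \<not> range (\<xi> n) \<subseteq> {y j}) \<and> backward_to (\<xi> n) {y (k n)} \<and> forward_to (\<xi> n) {y (k (n + 1))}"
      using het unfolding heteroclinic_structure_def by blast+
    have kp': "k (n + 1) \<in> {1..p}" if "n \<in> {1..l}" for n
    proof (cases "n = l")
      case True
      then show ?thesis
        using l kp[of 1] by simp
    next
      case False
      then show ?thesis
        using that by (intro kp) auto
    qed
    have steps: "(\<sigma> (k n), \<sigma> (k (n + 1))) \<in> connection\<^sup>+" if "n \<in> {1..l}" for n
      using \<xi>[OF that] kp[OF that] kp'[OF that] by (intro link[of _ _ "\<xi> n"]) auto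
    have "n \<le> l \<Longrightarrow> (\<sigma> (k 1), \<sigma> (k (n + 1))) \<in> connection\<^sup>+" if "n \<ge> 1" for n
      using that
    proof (induction n rule: dec_induct)
      case base
      then show ?case
        using steps[of 1] by simp
    next
      case (step n)
      then show ?case
        using steps[of "Suc n"] trancl_trans[of "\<sigma> (k 1)" "\<sigma> (k (n + 1))" connection] by simp
    qed
    from this[of l] show False
      using l acyclic_connection by (auto simp: acyclic_def)
  qed
  show ?thesis
    unfolding dynamically_gradient_def using gradient1 gradient2 by blast
qed

end

theorem proposition6p8:
  fixes T :: "real \<Rightarrow> 'a::banach \<Rightarrow> 'a"
    and A :: "real \<Rightarrow> 'a set"
    and U :: "'a set"
    and p :: nat
    and xstar :: "nat \<Rightarrow> real \<Rightarrow> 'a"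
  assumes cont: "\<forall>\<eta>\<in>{0..1}. continuous_on UNIV (T \<eta>)"
    and cac: "collectively_asymptotically_compact T"
    and cont0: "continuous_family_at_0 T"
    and attractor: "\<forall>\<eta>\<in>{0..1}. global_attractor (T \<eta>) (A \<eta>)"
    and precompact: "compact (closure (\<Union>\<eta>\<in>{0..1}. A \<eta>))"
    and nbhd: "(\<Union>\<eta>\<in>{0..1}. A \<eta>) \<subseteq> interior U"
    and lip_conv: "((\<lambda>\<eta>. triple_norm_on U (\<lambda>x. T \<eta> x - T 0 x)) \<longlongrightarrow> 0) (at_right 0)"
    and invariants: "\<forall>\<eta>\<in>{0..1}. isolated_invariant_family (T \<eta>) (A \<eta>) p (\<lambda>i. {xstar i \<eta>})"
    and equilibria: "\<forall>\<eta>\<in>{0..1}. \<forall>i\<in>{1..p}. equilibrium (T \<eta>) (xstar i \<eta>)"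
    and hyperbolic: "\<forall>i\<in>{1..p}. L_hyperbolic (T 0) (xstar i 0)"
    and gradient: "dynamically_gradient (T 0) p (\<lambda>i. {xstar i 0})"
  shows "\<exists>\<eta>1. 0 < \<eta>1 \<and> \<eta>1 \<le> 1 \<and>
    (\<forall>\<eta>\<in>{0..\<eta>1}. dynamically_gradient (T \<eta>) p (\<lambda>i. {xstar i \<eta>}) \<and>
       A \<eta> = (\<Union>i\<in>{1..p}. unstable_set (T \<eta>) (xstar i \<eta>)))"
proof -
  define K where "K = closure (\<Union>\<eta>\<in>{0..1}. A \<eta>)"
  define x where "x i = xstar i 0" for i
  have AK: "A \<eta> \<subseteq> K" if "\<eta> \<in> {0..1}" for \<eta>
    unfolding K_def using that by (intro order_trans[OF _ closure_subset]) blast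
  have K: "compact K"
    using precompact by (simp add: K_def)
  have fixp: "T \<eta> (xstar i \<eta>) = xstar i \<eta>" if "\<eta> \<in> {0..1}" "i \<in> {1..p}" for \<eta> i
    using equilibria that by (simp add: equilibrium_def)
  have inA: "xstar i \<eta> \<in> A \<eta>" if "\<eta> \<in> {0..1}" "i \<in> {1..p}" for \<eta> i
    by (rule isolated_points(1)[OF bspec[OF invariants that(1)] that(2)])
  have inj: "inj_on (\<lambda>i. xstar i \<eta>) {1..p}" if "\<eta> \<in> {0..1}" for \<eta>
    by (rule isolated_points(2)[OF bspec[OF invariants that]])
  have sync_ev: "eventually (\<lambda>r. eventually (\<lambda>\<eta>. synchronizing_on (ball (x i) r) (T \<eta>)) (at_right 0)) (at_right 0)"
    if i: "i \<in> {1..p}" for i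
  proof -
    have "L_hyperbolic (T 0) (x i)"
      using bspec[OF hyperbolic i] by (simp add: x_def)
    then obtain L N a b nrm \<gamma> where "weakly_hyperbolic_decomposition (T 0) (x i) L N a b nrm \<gamma>"
      unfolding L_hyperbolic_def by blast
    moreover have "A 0 \<subseteq> interior U"
      using nbhd by (intro order_trans[OF _ nbhd] UN_upper) simp
    then have "x i \<in> interior U"
      using inA[of 0 i] i by (auto simp: x_def)
    ultimately show ?thesis
      using lip_conv by (rule perturbations_synchronizing)
  qed
  have sep_ev: "eventually (\<lambda>r. i \<noteq> j \<longrightarrow> 2 * r < dist (x i) (x j)) (at_right 0)"
    if ij: "i \<in> {1..p}" "j \<in> {1..p}" for i j
  proof (cases "i = j")
    case False
    then have "dist (x i) (x j) > 0"
      using inj[of 0] ij by (auto simp: x_def dest: inj_onD)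
    then show ?thesis
      unfolding eventually_at_right_field by (intro exI[of _ "dist (x i) (x j) / 2"]) auto
  qed simp
  have "eventually (\<lambda>r. 0 < r \<and> (\<forall>i\<in>{1..p}. eventually (\<lambda>\<eta>. synchronizing_on (ball (x i) r) (T \<eta>)) (at_right 0)) \<and>
      (\<forall>i\<in>{1..p}. \<forall>j\<in>{1..p}. i \<noteq> j \<longrightarrow> 2 * r < dist (x i) (x j))) (at_right (0::real))"
    using sync_ev sep_ev eventually_at_right_less[of "0::real"]
    by (intro eventually_conj) (simp_all add: eventually_ball_finite)
  then obtain r where r: "0 < r"
    and sync: "\<forall>i\<in>{1..p}. eventually (\<lambda>\<eta>. synchronizing_on (ball (x i) r) (T \<eta>)) (at_right 0)"
    and sep: "\<forall>i\<in>{1..p}. \<forall>j\<in>{1..p}. i \<noteq> j \<longrightarrow> 2 * r < dist (x i) (x j)"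
    using eventually_happens'[OF trivial_limit_at_right_real] by blast
  interpret gradient_on_compact "T 0" K p x r
  proof
    show "continuous_on K (T 0)"
      using cont continuous_on_subset[of UNIV "T 0" K] by auto
    show "dynamically_gradient (T 0) p (\<lambda>i. {x i})"
      using gradient by (simp add: x_def)
    show "T 0 (x i) = x i" if "i \<in> {1..p}" for i
      using fixp[of 0 i] that by (simp add: x_def)
  qed (use K r sep in auto)
  obtain \<delta> where \<delta>: "\<delta> > 0" "\<delta> \<le> r" "settling \<delta>"
    using pseudo_orbits_settle by blast
  obtain \<delta>' N where \<delta>': "\<delta>' > 0" and hit: "\<And>\<xi> m. range \<xi> \<subseteq> K \<Longrightarrow> pseudo_orbit (T 0) \<delta>' \<xi> \<Longrightarrow>
     \<exists>t\<in>{m..m + int N}. \<exists>j\<in>{1..p}. dist (\<xi> t) (x j) < \<delta>"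
    using uniform_hitting_time[OF \<delta>(1)] by blast
  have "uniform_limit ({1..1} \<times> K) (\<lambda>\<eta> (n, x). (T \<eta> ^^ n) x) (\<lambda>(n, x). (T 0 ^^ n) x) (at_right 0)"
    using cont0 K unfolding continuous_family_at_0_def by blast
  then have "eventually (\<lambda>\<eta>. \<forall>nx\<in>{1..1} \<times> K. dist (case nx of (n, x) \<Rightarrow> (T \<eta> ^^ n) x)
      (case nx of (n, x) \<Rightarrow> (T 0 ^^ n) x) < min \<delta> \<delta>') (at_right 0)"
    by (rule uniform_limitD) (use \<delta>(1) \<delta>' in simp)
  then have close: "eventually (\<lambda>\<eta>. \<forall>u\<in>K. dist (T 0 u) (T \<eta> u) < min \<delta> \<delta>') (at_right 0)"
    by eventually_elim (auto simp: dist_commute)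
  have sync': "eventually (\<lambda>\<eta>. \<forall>i\<in>{1..p}. synchronizing_on (ball (x i) r) (T \<eta>)) (at_right 0)"
    using sync by (simp add: eventually_ball_finite)
  have "eventually (\<lambda>\<eta>::real. \<eta> \<in> {0..1}) (at_right 0)"
    unfolding eventually_at_right_field by (intro exI[of _ 1]) auto
  with close sync' have "eventually (\<lambda>\<eta>. dynamically_gradient (T \<eta>) p (\<lambda>i. {xstar i \<eta>})) (at_right 0)"
  proof eventually_elim
    case (elim \<eta>)
    note \<eta> = elim(3)
    have orb: "range \<xi> \<subseteq> K \<and> pseudo_orbit (T 0) (min \<delta> \<delta>') \<xi>"
      if sol: "global_solution (T \<eta>) \<xi>" and bd: "bounded (range \<xi>)" for \<xi>
    proof -
      have "\<xi> m \<in> A \<eta>" for m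
        using attractor \<eta> by (intro solution_in_attractor[OF _ sol] bounded_subset[OF bd]) auto
      then have "\<xi> m \<in> K" for m
        using AK[OF \<eta>] by auto
      then show ?thesis
        using elim(1) sol unfolding pseudo_orbit_def global_solution_def by (metis image_subsetI)
    qed
    show ?case
    proof (rule perturbation_dynamically_gradient[OF \<delta>(2,3)])
      show "synchronizing_on (ball (x i) r) (T \<eta>)" if "i \<in> {1..p}" for i
        using elim(2) that by blast
      show "range \<xi> \<subseteq> K \<and> pseudo_orbit (T 0) \<delta> \<xi>"
        if "global_solution (T \<eta>) \<xi>" "bounded (range \<xi>)" for \<xi>
        using orb[OF that] by (auto elim: pseudo_orbit_mono)
      show "\<exists>j\<in>{1..p}. dist (xstar i \<eta>) (x j) < \<delta>" if i: "i \<in> {1..p}" for i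
      proof -
        \<comment> \<open>an equilibrium of \<open>T \<eta>\<close> is a constant pseudo-orbit, which must be near some \<open>x j\<close> when it hits\<close>
        have const: "range (\<lambda>m::int. xstar i \<eta>) \<subseteq> K \<and> pseudo_orbit (T 0) (min \<delta> \<delta>') (\<lambda>m. xstar i \<eta>)"
          using fixp[OF \<eta> i] by (intro orb) (auto simp: global_solution_def)
        then have "pseudo_orbit (T 0) \<delta>' (\<lambda>m. xstar i \<eta>)"
          by (auto elim: pseudo_orbit_mono)
        from hit[OF conjunct1[OF const] this, of 0] show ?thesis
          by blast
      qed
    qed (use fixp[OF \<eta>] inj[OF \<eta>] in auto)
  qed
  then obtain b where b: "b > 0" "\<And>\<eta>. 0 < \<eta> \<Longrightarrow> \<eta> < b \<Longrightarrow> dynamically_gradient (T \<eta>) p (\<lambda>i. {xstar i \<eta>})"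
    unfolding eventually_at_right_field by blast
  define \<eta>1 where "\<eta>1 = min 1 (b / 2)"
  have \<eta>1: "0 < \<eta>1" "\<eta>1 \<le> 1" "\<eta>1 < b"
    using b(1) by (auto simp: \<eta>1_def)
  have dg: "dynamically_gradient (T \<eta>) p (\<lambda>i. {xstar i \<eta>})" if "\<eta> \<in> {0..\<eta>1}" for \<eta>
    using gradient b(2)[of \<eta>] that \<eta>1 by (cases "\<eta> = 0") (auto simp: x_def)
  moreover have "A \<eta> = (\<Union>i\<in>{1..p}. unstable_set (T \<eta>) (xstar i \<eta>))" if "\<eta> \<in> {0..\<eta>1}" for \<eta>
    using attractor \<eta>1 that by (intro attractor_eq_unstable_sets dg) auto
  ultimately show ?thesis
    using \<eta>1 by blast
qed

end
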